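(* Let $2\alpha+2\gamma>1$. Then, as $n\to\infty$, $$\|\phi_n^{(1)}\|=O\big(n^{-\alpha}\,\tau_{2\alpha,\gamma}(n)^{1/2}\big).$$ Additionally, if $2\alpha+\gamma>1$, then for every $k=2,3,\dots$, as $n\to\infty$, $$\|\phi_n^{(k)}\|=O\big(n^{-\alpha}\,\sigma_{2\alpha,\gamma}(n)^{k-1}\,\tau_{2\alpha,\gamma}(n)^{1/2}\big).$$
   Context: $H$ is a separable infinite-dimensional complex Hilbert space with inner product $(\cdot,\cdot)$ and norm $\|\cdot\|$. $a$ is a closed, densely defined, Hermitian, positive-definite sesquilinear form with domain $V\subset H$, and $A$ is the associated self-adjoint operator: $V=D(A^{1/2})$, $a(u,v)=(A^{1/2}u,A^{1/2}v)$. $A$ has compact resolvent, with eigenvalues $0<\mu_1\le\mu_2\le\dots$ (with multiplicity) and an orthonormal basis of eigenvectors $\psi_k$ of $H$. $b$ is a sesquilinear form on $V$ (continuous in the $V$-norm, hence determined by the values $b(\psi_m,\psi_n)$). Standing assumptions: there are $\gamma>0$, $\kappa>0$, $N_0>0$ with $\mu_{k+1}-\mu_k\ge\kappa k^{\gamma-1}$ for all $k\ge N_0$; and there are $\alpha\in\mathbb R$ with $2\alpha+\gamma>1$ and $M_b>0$ with $|b(\psi_m,\psi_n)|\le M_bm^{-\alpha}n^{-\alpha}$ for all $m,n\in\mathbb N$. For $z\in\rho(A)$: $K(z)u=\sum_k(z-\mu_k)^{-1/2}(u,\psi_k)\psi_k$ (with $w^s=|w|^se^{is\arg w}$, $\arg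 w\in(-\pi,\pi]$), and $B(z)$ is the bounded operator on $H$ determined by $(B(z)u,v)=b(K(z)u,K^\ast(z)v)$ for $u,v\in H$. For $n$ large let $\Gamma_n=\partial\Pi_n$, positively oriented, $\Pi_n=\{z\in\mathbb C:\mu_n-\frac\kappa2(n-1)^{\gamma-1}<\operatorname{Re}z<\mu_n+\frac\kappa2n^{\gamma-1},\ |\operatorname{Im}z|<\frac\kappa2n^{\gamma-1}\}$ (a contour around the single eigenvalue $\mu_n$ of $A$), and $$\phi_n^{(k)}=\frac1{2\pi i}\int_{\Gamma_n}K(z)B^k(z)K(z)\psi_n\,dz,\quad k=1,2,\dots$$ $\sigma_{\omega,\gamma}(n)=n^{-\omega-\gamma+1}\ln(en)$ if $\omega\le1$ and $n^{-\gamma}$ if $\omega>1$; $\tau_{\omega,\gamma}(n)=n^{-(\omega+2\gamma-2)}$ if $\omega\le2$ and $n^{-2\gamma}$ if $\omega>2$. *)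

theory Defs
  imports "HOL-Complex_Analysis.Complex_Analysis" "HOL-Library.Landau_Symbols"
begin

section \<open>Complex Hilbert spaces\<close>

text \<open>The inner product is linear in the first and antilinear in the second argument.
  Positivity and definiteness of the inner product follow from the last axiom,
  completeness from the class \<^class>\<open>banach\<close>.\<close>

class complex_hilbert = banach +
  fixes scaleC :: "complex \<Rightarrow> 'a \<Rightarrow> 'a"  (infixr "*\<^sub>C" 75)
    and cinner :: "'a \<Rightarrow> 'a \<Rightarrow> complex"
  assumes scaleC_add_right: "c *\<^sub>C (x + y) = c *\<^sub>C x + c *\<^sub>C y"
    and scaleC_add_left: "(c + d) *\<^sub>C x = c *\<^sub>C x + d *\<^sub>C x"
    and scaleC_scaleC: "c *\<^sub>C (d *\<^sub>C x) = (c * d) *\<^sub>C x"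
    and scaleC_one: "1 *\<^sub>C x = x"
    and scaleC_of_real: "complex_of_real r *\<^sub>C x = r *\<^sub>R x"
    and cinner_commute: "cinner x y = cnj (cinner y x)"
    and cinner_add_left: "cinner (x + y) z = cinner x z + cinner y z"
    and cinner_scaleC_left: "cinner (c *\<^sub>C x) y = c * cinner x y"
    and norm_eq_sqrt_cinner: "norm x = sqrt (Re (cinner x x))"

global_interpretation cvec: vector_space "scaleC :: complex \<Rightarrow> 'h \<Rightarrow> 'h::complex_hilbert"
  by unfold_locales
    (rule scaleC_add_right scaleC_add_left scaleC_scaleC scaleC_one)+

definition bounded_clinear :: "('h::complex_hilbert \<Rightarrow> 'h) \<Rightarrow> bool" where
  "bounded_clinear T \<longleftrightarrow> bounded_linear T \<and> (\<forall>c u. T (c *\<^sub>C u) = c *\<^sub>C T u)"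

definition hilbert_adjoint :: "('h::complex_hilbert \<Rightarrow> 'h) \<Rightarrow> 'h \<Rightarrow> 'h" where
  "hilbert_adjoint T = (THE S. bounded_clinear S \<and> (\<forall>u v. cinner (T u) v = cinner u (S v)))"

text \<open>Families indexed by \<open>k = 1, 2, \<dots>\<close> are functions on \<^typ>\<open>nat\<close> whose value at 0 is
  irrelevant.\<close>

definition orthonormal_basis :: "(nat \<Rightarrow> 'h::complex_hilbert) \<Rightarrow> bool" where
  "orthonormal_basis \<psi> \<longleftrightarrow>
     (\<forall>j\<ge>1. \<forall>k\<ge>1. cinner (\<psi> j) (\<psi> k) = (if j = k then 1 else 0)) \<and>
     closure (cvec.span (\<psi> ` {1..})) = UNIV"

section \<open>Unbounded operators\<close>

text \<open>An operator is given by its domain \<open>D\<close> and a function \<open>A\<close>, of which only the values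
  on \<open>D\<close> matter.\<close>

definition linear_operator :: "'h::complex_hilbert set \<Rightarrow> ('h \<Rightarrow> 'h) \<Rightarrow> bool" where
  "linear_operator D A \<longleftrightarrow> cvec.subspace D \<and>
     (\<forall>u\<in>D. \<forall>v\<in>D. A (u + v) = A u + A v) \<and> (\<forall>c. \<forall>u\<in>D. A (c *\<^sub>C u) = c *\<^sub>C A u)"

text \<open>The last conjunct says that the graph of \<open>A\<close> is the graph of its adjoint.\<close>

definition self_adjoint :: "'h::complex_hilbert set \<Rightarrow> ('h \<Rightarrow> 'h) \<Rightarrow> bool" where
  "self_adjoint D A \<longleftrightarrow> linear_operator D A \<and> closure D = UNIV \<and>
     (\<forall>v w. (v \<in> D \<and> A v = w) \<longleftrightarrow> (\<forall>u\<in>D. cinner (A u) v = cinner u w))"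

text \<open>\<open>S\<close> with domain \<open>V\<close> is \<open>A\<^sup>1\<^sup>/\<^sup>2\<close>.\<close>

definition square_root_of ::
    "'h::complex_hilbert set \<Rightarrow> ('h \<Rightarrow> 'h) \<Rightarrow> 'h set \<Rightarrow> ('h \<Rightarrow> 'h) \<Rightarrow> bool" where
  "square_root_of V S D A \<longleftrightarrow> self_adjoint V S \<and> (\<forall>u\<in>V. 0 \<le> Re (cinner (S u) u)) \<and>
     D = {u \<in> V. S u \<in> V} \<and> (\<forall>u\<in>D. S (S u) = A u)"

definition resolvent_set :: "'h::complex_hilbert set \<Rightarrow> ('h \<Rightarrow> 'h) \<Rightarrow> complex set" where
  "resolvent_set D A = {z. bij_betw (\<lambda>u. z *\<^sub>C u - A u) D UNIV \<and>
     bounded_clinear (inv_into D (\<lambda>u. z *\<^sub>C u - A u))}"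

definition compact_resolvent :: "'h::complex_hilbert set \<Rightarrow> ('h \<Rightarrow> 'h) \<Rightarrow> bool" where
  "compact_resolvent D A \<longleftrightarrow> (\<exists>z\<in>resolvent_set D A.
     compact (closure (inv_into D (\<lambda>u. z *\<^sub>C u - A u) ` cball 0 1)))"

section \<open>Sesquilinear forms\<close>

definition sesquilinear_on ::
    "'h::complex_hilbert set \<Rightarrow> ('h \<Rightarrow> 'h \<Rightarrow> complex) \<Rightarrow> bool" where
  "sesquilinear_on V a \<longleftrightarrow> cvec.subspace V \<and>
     (\<forall>u\<in>V. \<forall>v\<in>V. \<forall>w\<in>V. a (u + v) w = a u w + a v w \<and> a w (u + v) = a w u + a w v) \<and>
     (\<forall>c. \<forall>u\<in>V. \<forall>v\<in>V. a (c *\<^sub>C u) v = c * a u v \<and> a u (c *\<^sub>C v) = cnj c * a u v)"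

definition hermitian_on :: "'h set \<Rightarrow> ('h \<Rightarrow> 'h \<Rightarrow> complex) \<Rightarrow> bool" where
  "hermitian_on V a \<longleftrightarrow> (\<forall>u\<in>V. \<forall>v\<in>V. a u v = cnj (a v u))"

text \<open>For a Hermitian form \<open>a u u\<close> is real.\<close>

definition positive_definite_on :: "'h::zero set \<Rightarrow> ('h \<Rightarrow> 'h \<Rightarrow> complex) \<Rightarrow> bool" where
  "positive_definite_on V a \<longleftrightarrow> (\<forall>u\<in>V. u \<noteq> 0 \<longrightarrow> 0 < Re (a u u))"

definition form_norm :: "('h::complex_hilbert \<Rightarrow> 'h \<Rightarrow> complex) \<Rightarrow> 'h \<Rightarrow> real" where
  "form_norm a u = sqrt (Re (a u u) + (norm u)\<^sup>2)"

text \<open>Closedness of a nonnegative form: its domain is complete in the form norm.\<close>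

definition closed_form_on ::
    "'h::complex_hilbert set \<Rightarrow> ('h \<Rightarrow> 'h \<Rightarrow> complex) \<Rightarrow> bool" where
  "closed_form_on V a \<longleftrightarrow> (\<forall>x :: nat \<Rightarrow> 'h. (\<forall>n. x n \<in> V) \<and>
       (\<forall>e>0. \<exists>N. \<forall>m\<ge>N. \<forall>n\<ge>N. form_norm a (x m - x n) < e) \<longrightarrow>
     (\<exists>u\<in>V. (\<lambda>n. form_norm a (x n - u)) \<longlonglongrightarrow> 0))"

definition associated_operator ::
    "'h::complex_hilbert set \<Rightarrow> ('h \<Rightarrow> 'h \<Rightarrow> complex) \<Rightarrow> 'h set \<Rightarrow> ('h \<Rightarrow> 'h) \<Rightarrow> bool" where
  "associated_operator V a D A \<longleftrightarrow> self_adjoint D A \<and>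
     (\<exists>S. square_root_of V S D A \<and> (\<forall>u\<in>V. \<forall>v\<in>V. a u v = cinner (S u) (S v)))"

text \<open>Continuity of \<open>b\<close> on \<open>V\<close> equipped with the norm induced by the form \<open>a\<close>.\<close>

definition form_bounded_on ::
    "'h::complex_hilbert set \<Rightarrow> ('h \<Rightarrow> 'h \<Rightarrow> complex) \<Rightarrow> ('h \<Rightarrow> 'h \<Rightarrow> complex) \<Rightarrow> bool" where
  "form_bounded_on V a b \<longleftrightarrow>
     (\<exists>C. \<forall>u\<in>V. \<forall>v\<in>V. norm (b u v) \<le> C * form_norm a u * form_norm a v)"

section \<open>The perturbation series\<close>

text \<open>\<open>w powr s = exp (s * Ln w)\<close> with the principal branch \<open>-pi < Im (Ln w) \<le> pi\<close>.\<close>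

definition K_op :: "(nat \<Rightarrow> real) \<Rightarrow> (nat \<Rightarrow> 'h::complex_hilbert) \<Rightarrow> complex \<Rightarrow> 'h \<Rightarrow> 'h" where
  "K_op \<mu> \<psi> z u = (\<Sum>k. ((z - complex_of_real (\<mu> (Suc k))) powr (- 1 / 2) *
     cinner u (\<psi> (Suc k))) *\<^sub>C \<psi> (Suc k))"

definition B_op :: "(nat \<Rightarrow> real) \<Rightarrow> (nat \<Rightarrow> 'h::complex_hilbert) \<Rightarrow> ('h \<Rightarrow> 'h \<Rightarrow> complex) \<Rightarrow>
    complex \<Rightarrow> 'h \<Rightarrow> 'h" where
  "B_op \<mu> \<psi> b z = (THE T. bounded_clinear T \<and>
     (\<forall>u v. cinner (T u) v = b (K_op \<mu> \<psi> z u) (hilbert_adjoint (K_op \<mu> \<psi> z) v)))"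

text \<open>The vector-valued analogue of \<^const>\<open>contour_integral\<close>.\<close>

definition vector_contour_integral ::
    "(real \<Rightarrow> complex) \<Rightarrow> (complex \<Rightarrow> 'h::complex_hilbert) \<Rightarrow> 'h" where
  "vector_contour_integral g f =
     integral {0..1} (\<lambda>t. vector_derivative g (at t within {0..1}) *\<^sub>C f (g t))"

text \<open>\<^term>\<open>rectpath p q\<close> is the positively oriented boundary of \<^term>\<open>box p q\<close> when
  \<open>p\<close> is the lower left and \<open>q\<close> the upper right corner.\<close>

definition Gamma_contour :: "real \<Rightarrow> real \<Rightarrow> (nat \<Rightarrow> real) \<Rightarrow> nat \<Rightarrow> real \<Rightarrow> complex" where
  "Gamma_contour \<kappa> \<gamma> \<mu> n = rectpath
     (Complex (\<mu> n - \<kappa> / 2 * (real n - 1) powr (\<gamma> - 1)) (- (\<kappa> / 2 * real n powr (\<gamma> - 1))))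
     (Complex (\<mu> n + \<kappa> / 2 * real n powr (\<gamma> - 1)) (\<kappa> / 2 * real n powr (\<gamma> - 1)))"

definition phi :: "real \<Rightarrow> real \<Rightarrow> (nat \<Rightarrow> real) \<Rightarrow> (nat \<Rightarrow> 'h::complex_hilbert) \<Rightarrow>
    ('h \<Rightarrow> 'h \<Rightarrow> complex) \<Rightarrow> nat \<Rightarrow> nat \<Rightarrow> 'h" where
  "phi \<kappa> \<gamma> \<mu> \<psi> b k n = (1 / (2 * complex_of_real pi * \<i>)) *\<^sub>C
     vector_contour_integral (Gamma_contour \<kappa> \<gamma> \<mu> n)
       (\<lambda>z. K_op \<mu> \<psi> z ((B_op \<mu> \<psi> b z ^^ k) (K_op \<mu> \<psi> z (\<psi> n))))"

definition sigma_rate :: "real \<Rightarrow> real \<Rightarrow> nat \<Rightarrow> real" where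
  "sigma_rate \<omega> \<gamma> n = (if \<omega> \<le> 1 then real n powr (- \<omega> - \<gamma> + 1) * ln (exp 1 * real n)
     else real n powr (- \<gamma>))"

definition tau_rate :: "real \<Rightarrow> real \<Rightarrow> nat \<Rightarrow> real" where
  "tau_rate \<omega> \<gamma> n = (if \<omega> \<le> 2 then real n powr (- (\<omega> + 2 * \<gamma> - 2))
     else real n powr (- 2 * \<gamma>))"

end

theory Submission
  imports Defs
begin

text \<open>In the basis \<open>\<psi>\<close> the operator \<open>K(z)\<close> is diagonal and \<open>B(z)\<close> has the matrix entries
  \<open>b(\<psi>\<^sub>l, \<psi>\<^sub>m) (z - \<mu>\<^sub>l)\<^sup>-\<^sup>1\<^sup>/\<^sup>2 (z - \<mu>\<^sub>m)\<^sup>-\<^sup>1\<^sup>/\<^sup>2\<close>. Hence the \<open>m\<close>-th coordinate of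
  \<open>B(z)\<^sup>k K(z) \<psi>\<^sub>n\<close> is at most
  \<open>M n\<^sup>-\<^sup>\<alpha> |z - \<mu>\<^sub>n|\<^sup>-\<^sup>1 (M S)\<^sup>k\<^sup>-\<^sup>1 m\<^sup>-\<^sup>\<alpha> |z - \<mu>\<^sub>m|\<^sup>-\<^sup>1\<^sup>/\<^sup>2\<close>, where \<open>S\<close> is the sum of
  \<open>l\<^sup>-\<^sup>2\<^sup>\<alpha> |z - \<mu>\<^sub>l|\<^sup>-\<^sup>1\<close>. On \<open>\<Gamma>\<^sub>n\<close> the gap condition gives
  \<open>|z - \<mu>\<^sub>m| \<ge> c max(1, |m - n|) max(m, n)\<^sup>\<gamma>\<^sup>-\<^sup>1\<close>, which turns \<open>S\<close> into \<open>O(\<sigma>(n))\<close> and the sum of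
  \<open>l\<^sup>-\<^sup>2\<^sup>\<alpha> |z - \<mu>\<^sub>l|\<^sup>-\<^sup>2\<close>, which comes from the norm of \<open>K(z)\<close> applied last, into \<open>O(\<tau>(n))\<close>.
  Since \<open>|z - \<mu>\<^sub>n|\<^sup>-\<^sup>1\<close> compensates the length of the contour, the bound on the integrand
  is already the claim, and no residue has to be computed.\<close>

section \<open>Complex Hilbert spaces\<close>

lemma cinner_add_right: "cinner x (y + z) = cinner x y + cinner x (z::'h::complex_hilbert)"
  by (metis cinner_add_left cinner_commute complex_cnj_add)

lemma cinner_scaleC_right: "cinner x (c *\<^sub>C y) = cnj c * cinner x (y::'h::complex_hilbert)"
  by (metis cinner_scaleC_left cinner_commute complex_cnj_mult)

lemma cinner_zero_left [simp]: "cinner 0 (y::'h::complex_hilbert) = 0"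
  by (metis cinner_add_left add_cancel_right_left)

lemma cinner_zero_right [simp]: "cinner (x::'h::complex_hilbert) 0 = 0"
  by (metis cinner_add_right add_cancel_right_left)

lemma cinner_diff_left: "cinner (x - y) z = cinner x z - cinner y (z::'h::complex_hilbert)"
  by (metis cinner_add_left add_diff_cancel diff_add_cancel)

lemma cinner_diff_right: "cinner x (y - z) = cinner x y - cinner x (z::'h::complex_hilbert)"
  by (metis cinner_add_right add_diff_cancel diff_add_cancel)

lemma cinner_sum_left: "cinner (\<Sum>k\<in>A. f k) (z::'h::complex_hilbert) = (\<Sum>k\<in>A. cinner (f k) z)"
  by (induction A rule: infinite_finite_induct) (auto simp: cinner_add_left)

lemma cinner_sum_right: "cinner (z::'h::complex_hilbert) (\<Sum>k\<in>A. f k) = (\<Sum>k\<in>A. cinner z (f k))"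
  by (induction A rule: infinite_finite_induct) (auto simp: cinner_add_right)

lemma cinner_self: "cinner x x = complex_of_real ((norm (x::'h::complex_hilbert))\<^sup>2)"
proof -
  \<comment> \<open>Positivity of \<open>cinner\<close> is not an axiom. The HOL root of a negative
    number is negative, so a nonnegative norm forces a nonnegative radicand.\<close>
  have "0 \<le> sqrt (Re (cinner x x))"
    using norm_ge_zero[of x] by (simp only: norm_eq_sqrt_cinner)
  then have "(norm x)\<^sup>2 = Re (cinner x x)"
    by (simp add: norm_eq_sqrt_cinner)
  moreover have "Im (cinner x x) = 0"
    using cinner_commute[of x x] by (simp add: complex_eq_iff)
  ultimately show ?thesis
    by (simp add: complex_eq_iff)
qed

lemma cmod_power2_eq: "(complex_of_real (cmod z))\<^sup>2 = z * cnj z"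
  using complex_norm_square[of z] by simp

lemma norm_scaleC: "norm (c *\<^sub>C x) = cmod c * norm (x::'h::complex_hilbert)"
proof -
  have "cinner (c *\<^sub>C x) (c *\<^sub>C x) = complex_of_real ((cmod c * norm x)\<^sup>2)"
    unfolding cinner_scaleC_left cinner_scaleC_right
    by (simp add: cinner_self cmod_power2_eq power_mult_distrib mult_ac)
  then have "complex_of_real ((norm (c *\<^sub>C x))\<^sup>2) = complex_of_real ((cmod c * norm x)\<^sup>2)"
    by (simp only: cinner_self)
  then have "(norm (c *\<^sub>C x))\<^sup>2 = (cmod c * norm x)\<^sup>2"
    using of_real_eq_iff by blast
  then show ?thesis
    by (simp add: power2_eq_iff_nonneg)
qed

lemma cauchy_schwarz: "cmod (cinner x y) \<le> norm x * norm (y::'h::complex_hilbert)"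
proof (cases "y = 0")
  case False
  \<comment> \<open>\<open>c *\<^sub>C y\<close> is the orthogonal projection of \<open>x\<close>
    onto \<open>y\<close>; the inequality says that the remainder has nonnegative squared
    norm.\<close>
  define c where "c = cinner x y / complex_of_real ((norm y)\<^sup>2)"
  have ny: "norm y > 0"
    using False by simp
  have c: "c * cinner y x = complex_of_real ((cmod (cinner x y))\<^sup>2 / (norm y)\<^sup>2)"
    by (simp add: c_def cmod_power2_eq flip: cinner_commute)
  have c': "cnj c * cinner x y = complex_of_real ((cmod (cinner x y))\<^sup>2 / (norm y)\<^sup>2)"
    by (simp add: c_def cmod_power2_eq mult.commute)
  have c'': "cnj c * (c * cinner y y) = cnj c * cinner x y"
    using ny by (simp add: c_def cinner_self)
  have "complex_of_real ((norm (x - c *\<^sub>C y))\<^sup>2) = cinner (x - c *\<^sub>C y) (x - c *\<^sub>C y)"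
    by (simp only: cinner_self)
  also have "\<dots> = cinner x x - c * cinner y x - (cnj c * cinner x y - cnj c * (c * cinner y y))"
    by (simp add: cinner_diff_left cinner_diff_right cinner_scaleC_left cinner_scaleC_right
        algebra_simps)
  also have "\<dots> = complex_of_real ((norm x)\<^sup>2 - (cmod (cinner x y))\<^sup>2 / (norm y)\<^sup>2)"
    unfolding c'' c by (simp add: cinner_self)
  finally have "(norm (x - c *\<^sub>C y))\<^sup>2 = (norm x)\<^sup>2 - (cmod (cinner x y))\<^sup>2 / (norm y)\<^sup>2"
    using of_real_eq_iff by blast
  then have "(cmod (cinner x y))\<^sup>2 / (norm y)\<^sup>2 \<le> (norm x)\<^sup>2"
    by (metis diff_ge_0_iff_ge zero_le_power2)
  then have "(cmod (cinner x y))\<^sup>2 \<le> (norm x * norm y)\<^sup>2"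
    using ny by (simp add: divide_simps power_mult_distrib)
  then show ?thesis
    by (simp add: power2_le_iff_abs_le)
qed simp

lemma bounded_linear_cinner_left: "bounded_linear (\<lambda>x. cinner x (y::'h::complex_hilbert))"
proof (rule bounded_linear_intro)
  show "cinner (r *\<^sub>R x) y = r *\<^sub>R cinner x y" for r x
    by (metis scaleC_of_real cinner_scaleC_left scaleR_conv_of_real)
  show "norm (cinner x y) \<le> norm x * norm y" for x
    by (rule cauchy_schwarz)
qed (auto simp: cinner_add_left)

lemma bounded_linear_cinner_right: "bounded_linear (\<lambda>y. cinner (x::'h::complex_hilbert) y)"
proof (rule bounded_linear_intro)
  show "cinner x (r *\<^sub>R y) = r *\<^sub>R cinner x y" for r y
    by (metis scaleC_of_real cinner_scaleC_right scaleR_conv_of_real complex_cnj_complex_of_real)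
  show "norm (cinner x y) \<le> norm y * norm x" for y
    by (metis cauchy_schwarz mult.commute)
qed (auto simp: cinner_add_right)

lemma bounded_clinearI:
  fixes T :: "'h::complex_hilbert \<Rightarrow> 'h"
  assumes "\<And>u v. T (u + v) = T u + T v" "\<And>c u. T (c *\<^sub>C u) = c *\<^sub>C T u"
    and "\<And>u. norm (T u) \<le> C * norm u"
  shows "bounded_clinear T"
proof -
  have "bounded_linear T"
  proof (rule bounded_linear_intro)
    show "T (r *\<^sub>R x) = r *\<^sub>R T x" for r x
      by (metis assms(2) scaleC_of_real)
    show "norm (T x) \<le> norm x * C" for x
      by (metis assms(3) mult.commute)
  qed (fact assms(1))
  then show ?thesis
    using assms(2) by (auto simp: bounded_clinear_def)
qed

lemma cinner_right_eqI:
  assumes "\<And>u. cinner u x = cinner u (y::'h::complex_hilbert)"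
  shows "x = y"
proof -
  have "cinner (x - y) (x - y) = 0"
    using assms[of "x - y"] by (simp add: cinner_diff_right)
  then show ?thesis
    by (simp add: cinner_self)
qed

lemma cinner_left_eqI:
  assumes "\<And>v. cinner x v = cinner (y::'h::complex_hilbert) v"
  shows "x = y"
  using assms by (metis cinner_commute cinner_right_eqI)

text \<open>Opens the definite description: the witness gives existence, and the adjoint identity
  determines every value, which gives uniqueness.\<close>

lemma hilbert_adjoint_eqI:
  fixes T S :: "'h::complex_hilbert \<Rightarrow> 'h"
  assumes "bounded_clinear S" "\<And>u v. cinner (T u) v = cinner u (S v)"
  shows "hilbert_adjoint T = S"
  unfolding hilbert_adjoint_def
proof (rule the_equality)
  fix S' assume S': "bounded_clinear S' \<and> (\<forall>u v. cinner (T u) v = cinner u (S' v))"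
  show "S' = S"
  proof
    fix v show "S' v = S v"
      by (rule cinner_right_eqI) (metis S' assms(2))
  qed
qed (use assms in auto)

section \<open>Expansions with respect to an orthonormal basis\<close>

text \<open>Indexed from 0 to match series over \<open>nat\<close>; the family
  \<open>\<psi>\<close>, which starts at 1, enters later as
  \<open>\<lambda>k. \<psi> (Suc k)\<close>.\<close>

locale hilbert_basis =
  fixes e :: "nat \<Rightarrow> 'h::complex_hilbert"
  assumes orthonormal: "cinner (e j) (e k) = (if j = k then 1 else 0)"
    and dense: "closure (cvec.span (range e)) = UNIV"
begin

lemma cinner_sum_basis:
  assumes "finite A"
  shows "cinner (\<Sum>k\<in>A. c k *\<^sub>C e k) (e j) = (if j \<in> A then c j else 0)"
  using assms by (simp add: cinner_sum_left cinner_scaleC_left orthonormal if_distrib cong: if_cong)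

lemma norm_sum_basis:
  assumes "finite A"
  shows "(norm (\<Sum>k\<in>A. c k *\<^sub>C e k))\<^sup>2 = (\<Sum>k\<in>A. (cmod (c k))\<^sup>2)"
proof -
  let ?s = "\<Sum>k\<in>A. c k *\<^sub>C e k"
  have "cinner ?s ?s = (\<Sum>k\<in>A. cnj (c k) * cinner ?s (e k))"
    by (simp only: cinner_sum_right cinner_scaleC_right)
  also have "\<dots> = (\<Sum>k\<in>A. complex_of_real ((cmod (c k))\<^sup>2))"
    by (rule sum.cong) (auto simp: cinner_sum_basis[OF assms] complex_norm_square mult.commute
        simp flip: of_real_power)
  finally show ?thesis
    by (metis cinner_self of_real_eq_iff of_real_sum)
qed

text \<open>By orthonormality the squared norm of a block is the block of squared coefficients, so
  the Cauchy criterion with \<open>r\<^sup>2\<close> for the numbers is the one with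
  \<open>r\<close> for the vectors.\<close>

lemma summable_basis:
  assumes "summable (\<lambda>k. (cmod (c k))\<^sup>2)"
  shows "summable (\<lambda>k. c k *\<^sub>C e k)"
  unfolding summable_Cauchy
proof (intro allI impI)
  fix r :: real assume "r > 0"
  then obtain N where N: "norm (\<Sum>k\<in>{m..<n}. (cmod (c k))\<^sup>2) < r\<^sup>2" if "m \<ge> N" for m n
    using assms[unfolded summable_Cauchy, rule_format, of "r\<^sup>2"] by auto
  have "norm (\<Sum>k\<in>{m..<n}. c k *\<^sub>C e k) < r" if "m \<ge> N" for m n
  proof (rule power_less_imp_less_base)
    show "(norm (\<Sum>k\<in>{m..<n}. c k *\<^sub>C e k))\<^sup>2 < r\<^sup>2"
      using N[OF that, of n] by (simp add: norm_sum_basis)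
  qed (use \<open>r > 0\<close> in simp)
  then show "\<exists>N. \<forall>m\<ge>N. \<forall>n. norm (\<Sum>k\<in>{m..<n}. c k *\<^sub>C e k) < r"
    by blast
qed

lemma cinner_series_basis:
  assumes "summable (\<lambda>k. (cmod (c k))\<^sup>2)"
  shows "cinner (\<Sum>k. c k *\<^sub>C e k) (e j) = c j"
proof -
  have "(\<lambda>k. cinner (c k *\<^sub>C e k) (e j)) sums cinner (\<Sum>k. c k *\<^sub>C e k) (e j)"
    by (rule bounded_linear.sums[OF bounded_linear_cinner_left])
      (use summable_basis[OF assms] in \<open>rule summable_sums\<close>)
  moreover have "(\<lambda>k. cinner (c k *\<^sub>C e k) (e j)) sums c j"
    using sums_single[of j c] by (simp add: cinner_scaleC_left orthonormal if_distrib cong: if_cong)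
  ultimately show ?thesis
    using sums_unique2 by blast
qed

lemma bessel:
  shows "(\<Sum>k<n. (cmod (cinner u (e k)))\<^sup>2) \<le> (norm u)\<^sup>2"
    and "summable (\<lambda>k. (cmod (cinner u (e k)))\<^sup>2)"
proof -
  show *: "(\<Sum>k<n. (cmod (cinner u (e k)))\<^sup>2) \<le> (norm u)\<^sup>2" for n
  proof -
    \<comment> \<open>For this projection \<open>cinner u s\<close> equals the squared norm of
      \<open>s\<close>, so Cauchy-Schwarz bounds \<open>norm s\<close> by
      \<open>norm u\<close>.\<close>
    define s where "s = (\<Sum>k<n. cinner u (e k) *\<^sub>C e k)"
    have "cinner u s = (\<Sum>k<n. complex_of_real ((cmod (cinner u (e k)))\<^sup>2))"
      by (simp add: s_def cinner_sum_right cinner_scaleC_right complex_norm_square mult.commute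
          flip: of_real_power)
    also have "\<dots> = complex_of_real ((norm s)\<^sup>2)"
      by (simp add: s_def norm_sum_basis flip: of_real_sum of_real_power)
    finally have "(norm s)\<^sup>2 = cmod (cinner u s)"
      by (simp add: norm_power)
    also have "\<dots> \<le> norm u * norm s"
      by (rule cauchy_schwarz)
    finally have "norm s \<le> norm u"
      by (metis mult_le_cancel_right norm_ge_zero power2_eq_square less_eq_real_def
          linorder_not_le)
    then have "(norm s)\<^sup>2 \<le> (norm u)\<^sup>2"
      by (simp add: power_mono)
    then show ?thesis
      by (simp add: s_def norm_sum_basis)
  qed
  show "summable (\<lambda>k. (cmod (cinner u (e k)))\<^sup>2)"
    by (rule summableI_nonneg_bounded[OF _ *]) simp
qed

text \<open>The vectors orthogonal to \<open>u\<close> form a closed set containing the span of the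
  basis, hence everything, and in particular \<open>u\<close> itself.\<close>

lemma eq_zeroI:
  assumes "\<And>k. cinner u (e k) = 0"
  shows "u = 0"
proof -
  have "cinner u v = 0" for v
  proof -
    have "cinner u w = 0" if "w \<in> cvec.span (range e)" for w
      using that
      by (induction rule: cvec.span_induct_alt) (auto simp: cinner_add_right cinner_scaleC_right assms)
    moreover have "closed {w. cinner u w = 0}"
      using bounded_linear.continuous_on[OF bounded_linear_cinner_right continuous_on_id]
      by (intro closed_Collect_eq continuous_on_const) auto
    ultimately have "closure (cvec.span (range e)) \<subseteq> {w. cinner u w = 0}"
      by (intro closure_minimal) auto
    then show ?thesis
      using dense by auto
  qed
  from this[of u] show ?thesis
    by (simp add: cinner_self)
qed

lemma basis_eqI:
  assumes "\<And>k. cinner u (e k) = cinner v (e k)"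
  shows "u = v"
  using eq_zeroI[of "u - v"] assms by (simp add: cinner_diff_left)

text \<open>The series converges by Bessel's inequality, and its sum has the same coordinates as
  \<open>u\<close>.\<close>

lemma basis_expansion: "(\<lambda>k. cinner u (e k) *\<^sub>C e k) sums u"
proof -
  have "(\<Sum>k. cinner u (e k) *\<^sub>C e k) = u"
    by (rule basis_eqI) (simp add: cinner_series_basis bessel)
  then show ?thesis
    using summable_sums[OF summable_basis[OF bessel(2)[of u]]] by simp
qed

lemma cinner_sums: "(\<lambda>k. cinner u (e k) * cnj (cinner v (e k))) sums cinner u v"
  using bounded_linear.sums[OF bounded_linear_cinner_left[of v] basis_expansion[of u]]
  by (simp add: cinner_scaleC_left flip: cinner_commute)

lemma parseval: "(\<lambda>k. (cmod (cinner u (e k)))\<^sup>2) sums (norm u)\<^sup>2"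
proof -
  have "(\<lambda>k. complex_of_real ((cmod (cinner u (e k)))\<^sup>2)) sums complex_of_real ((norm u)\<^sup>2)"
    using cinner_sums[of u u] by (simp add: cinner_self complex_norm_square flip: of_real_power)
  then show ?thesis
    by (simp only: sums_of_real_iff)
qed

lemma norm_le_coeffs:
  assumes "\<And>k. cmod (cinner u (e k)) \<le> g k" "summable (\<lambda>k. (g k)\<^sup>2)"
  shows "norm u \<le> sqrt (\<Sum>k. (g k)\<^sup>2)"
proof (rule real_le_rsqrt)
  show "(norm u)\<^sup>2 \<le> (\<Sum>k. (g k)\<^sup>2)"
    unfolding sums_unique[OF parseval]
    by (rule suminf_le) (use assms bessel(2) in \<open>auto intro: power_mono\<close>)
qed

section \<open>Operators diagonal in the basis\<close>

definition diag_op :: "(nat \<Rightarrow> complex) \<Rightarrow> 'h \<Rightarrow> 'h" where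
  "diag_op l u = (\<Sum>k. (l k * cinner u (e k)) *\<^sub>C e k)"

lemma summable_diag:
  assumes "\<And>k. cmod (l k) \<le> L"
  shows "summable (\<lambda>k. (cmod (l k * cinner u (e k)))\<^sup>2)"
proof (rule summable_comparison_test')
  show "summable (\<lambda>k. L\<^sup>2 * (cmod (cinner u (e k)))\<^sup>2)"
    by (intro summable_mult bessel)
  show "norm ((cmod (l k * cinner u (e k)))\<^sup>2) \<le> L\<^sup>2 * (cmod (cinner u (e k)))\<^sup>2" if "k \<ge> 0" for k
    using assms[of k] by (auto simp: norm_mult power_mult_distrib intro!: mult_right_mono power_mono)
qed

lemma cinner_diag_op:
  assumes "\<And>k. cmod (l k) \<le> L"
  shows "cinner (diag_op l u) (e k) = l k * cinner u (e k)"
  unfolding diag_op_def by (rule cinner_series_basis[OF summable_diag[OF assms]])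

lemma diag_op_basis:
  assumes "\<And>k. cmod (l k) \<le> L"
  shows "diag_op l (e k) = l k *\<^sub>C e k"
  by (rule basis_eqI) (auto simp: cinner_diag_op[OF assms] cinner_scaleC_left orthonormal)

lemma bounded_clinear_diag_op:
  assumes "\<And>k. cmod (l k) \<le> L"
  shows "bounded_clinear (diag_op l)"
proof (rule bounded_clinearI)
  show "diag_op l (u + v) = diag_op l u + diag_op l v" for u v
    by (rule basis_eqI) (simp add: cinner_diag_op[OF assms] cinner_add_left algebra_simps)
  show "diag_op l (c *\<^sub>C u) = c *\<^sub>C diag_op l u" for c u
    by (rule basis_eqI) (simp add: cinner_diag_op[OF assms] cinner_scaleC_left algebra_simps)
  have L: "0 \<le> L"
    using assms[of 0] norm_ge_zero order_trans by blast
  show "norm (diag_op l u) \<le> L * norm u" for u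
  proof -
    have "norm (diag_op l u) \<le> sqrt (\<Sum>k. (L * cmod (cinner u (e k)))\<^sup>2)"
    proof (rule norm_le_coeffs)
      show "cmod (cinner (diag_op l u) (e k)) \<le> L * cmod (cinner u (e k))" for k
        using assms[of k] by (simp add: cinner_diag_op[OF assms] norm_mult mult_right_mono)
    qed (use bessel in \<open>auto simp: power_mult_distrib intro: summable_mult\<close>)
    also have "(\<Sum>k. (L * cmod (cinner u (e k)))\<^sup>2) = (L * norm u)\<^sup>2"
      using sums_unique[OF sums_mult[OF parseval, of "L\<^sup>2" u]] by (simp add: power_mult_distrib)
    finally show ?thesis
      using L by simp
  qed
qed

lemma hilbert_adjoint_diag_op:
  assumes "\<And>k. cmod (l k) \<le> L"
  shows "hilbert_adjoint (diag_op l) = diag_op (\<lambda>k. cnj (l k))"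
proof (rule hilbert_adjoint_eqI)
  have cnj: "cmod (cnj (l k)) \<le> L" for k
    using assms by simp
  show "bounded_clinear (diag_op (\<lambda>k. cnj (l k)))"
    by (rule bounded_clinear_diag_op[OF cnj])
  show "cinner (diag_op l u) v = cinner u (diag_op (\<lambda>k. cnj (l k)) v)" for u v
    using cinner_sums[of "diag_op l u" v] cinner_sums[of u "diag_op (\<lambda>k. cnj (l k)) v"]
    by (simp add: cinner_diag_op[OF assms] cinner_diag_op[OF cnj] mult_ac sums_unique2)
qed

section \<open>Riesz representation and operators of bounded forms\<close>

lemma riesz_representation:
  fixes F :: "'h \<Rightarrow> complex"
  assumes add: "\<And>v w. F (v + w) = F v + F w" and scale: "\<And>c v. F (c *\<^sub>C v) = cnj c * F v"
    and bound: "\<And>v. cmod (F v) \<le> C * norm v"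
  obtains w where "\<And>v. cinner w v = F v" "norm w \<le> C"
proof -
  have F_lin: "bounded_linear F"
  proof (rule bounded_linear_intro)
    show "F (r *\<^sub>R x) = r *\<^sub>R F x" for r x
      by (metis scaleC_of_real scale scaleR_conv_of_real complex_cnj_complex_of_real)
    show "norm (F x) \<le> norm x * C" for x
      by (metis bound mult.commute)
  qed (fact add)
  have C: "0 \<le> C"
  proof -
    \<comment> \<open>A nonzero vector is needed to read \<open>0 \<le> C\<close> off the
      bound.\<close>
    have "e 0 \<noteq> 0"
      using orthonormal[of 0 0] by force
    moreover have "0 \<le> C * norm (e 0)"
      using bound[of "e 0"] norm_ge_zero order_trans by blast
    ultimately show ?thesis
      by (simp add: zero_le_mult_iff)
  qed
  have partial: "(\<Sum>k<n. (cmod (F (e k)))\<^sup>2) \<le> C\<^sup>2" for n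
  proof -
    \<comment> \<open>The representing vector must have the coordinates \<open>F (e k)\<close>.
      Testing \<open>F\<close> on its partial sums, where \<open>F\<close> takes the value of the
      squared norm, shows that these are square summable.\<close>
    define s where "s = (\<Sum>k<n. F (e k) *\<^sub>C e k)"
    have "F s = (\<Sum>k<n. complex_of_real ((cmod (F (e k)))\<^sup>2))"
      by (simp add: s_def linear_sum[OF bounded_linear.linear[OF F_lin]] scale complex_norm_square
          mult.commute flip: of_real_power)
    also have "\<dots> = complex_of_real ((norm s)\<^sup>2)"
      by (simp add: s_def norm_sum_basis flip: of_real_sum of_real_power)
    finally have "(norm s)\<^sup>2 = cmod (F s)"
      by (simp add: norm_power)
    also have "\<dots> \<le> C * norm s"
      by (rule bound)
    finally have "norm s \<le> C"
      using C by (cases "norm s = 0") (auto simp: power2_eq_square)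
    then have "(norm s)\<^sup>2 \<le> C\<^sup>2"
      by (simp add: power_mono)
    then show ?thesis
      by (simp add: s_def norm_sum_basis)
  qed
  have sq: "summable (\<lambda>k. (cmod (F (e k)))\<^sup>2)"
    by (rule summableI_nonneg_bounded[OF _ partial]) simp
  define w where "w = (\<Sum>k. F (e k) *\<^sub>C e k)"
  have w: "cinner w (e k) = F (e k)" for k
    unfolding w_def by (rule cinner_series_basis[OF sq])
  have "cinner w v = F v" for v
  proof -
    have "(\<lambda>k. cinner w (e k) * cnj (cinner v (e k))) sums F v"
      using bounded_linear.sums[OF F_lin basis_expansion[of v]] by (simp add: scale w mult.commute)
    then show ?thesis
      using cinner_sums sums_unique2 by blast
  qed
  moreover have "(norm w)\<^sup>2 \<le> C\<^sup>2"
    unfolding sums_unique[OF parseval] w by (rule suminf_le_const[OF sq partial])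
  then have "norm w \<le> C"
    using C by (simp add: power2_le_iff_abs_le)
  ultimately show thesis
    using that by blast
qed

text \<open>Unique existence is what makes the definite description in \<open>B_op\<close>
  meaningful. The value \<open>T u\<close> is the Riesz vector of the antilinear functional
  \<open>G u\<close>.\<close>

lemma bounded_form_operator:
  fixes G :: "'h \<Rightarrow> 'h \<Rightarrow> complex"
  assumes add_left: "\<And>u v w. G (u + v) w = G u w + G v w"
    and scale_left: "\<And>c u w. G (c *\<^sub>C u) w = c * G u w"
    and add_right: "\<And>u v w. G u (v + w) = G u v + G u w"
    and scale_right: "\<And>c u w. G u (c *\<^sub>C w) = cnj c * G u w"
    and bound: "\<And>u v. cmod (G u v) \<le> C * norm u * norm v"
  shows "\<exists>!T. bounded_clinear T \<and> (\<forall>u v. cinner (T u) v = G u v)"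
proof -
  have "\<exists>w. (\<forall>v. cinner w v = G u v) \<and> norm w \<le> C * norm u" for u
    by (rule riesz_representation[of "G u" "C * norm u"]) (auto simp: add_right scale_right bound)
  then obtain T where T: "\<And>u v. cinner (T u) v = G u v" "\<And>u. norm (T u) \<le> C * norm u"
    by metis
  show ?thesis
  proof (rule ex1I)
    have "bounded_clinear T"
    proof (rule bounded_clinearI[OF _ _ T(2)])
      show "T (u + v) = T u + T v" for u v
        by (rule cinner_left_eqI) (simp add: T cinner_add_left add_left)
      show "T (c *\<^sub>C u) = c *\<^sub>C T u" for c u
        by (rule cinner_left_eqI) (simp add: T cinner_scaleC_left scale_left)
    qed
    then show "bounded_clinear T \<and> (\<forall>u v. cinner (T u) v = G u v)"
      using T by blast
  next
    fix T' assume T': "bounded_clinear T' \<and> (\<forall>u v. cinner (T' u) v = G u v)"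
    show "T' = T"
    proof
      show "T' u = T u" for u
        by (rule cinner_left_eqI) (simp add: T T')
    qed
  qed
qed

end

section \<open>Forms diagonalised by a basis\<close>

lemma sesquilinear_on_zero:
  assumes "sesquilinear_on V a" "v \<in> V"
  shows "a 0 v = 0" "a v 0 = 0"
proof -
  have "a (0 *\<^sub>C v) v = 0 * a v v" "a v (0 *\<^sub>C v) = cnj 0 * a v v"
    using assms unfolding sesquilinear_on_def by blast+
  then show "a 0 v = 0" "a v 0 = 0"
    by simp_all
qed

lemma sesquilinear_on_diff:
  assumes "sesquilinear_on V a" "u \<in> V" "v \<in> V" "w \<in> V"
  shows "a (u - v) w = a u w - a v w" "a w (u - v) = a w u - a w v"
proof -
  have "u - v \<in> V"
    using assms cvec.subspace_diff unfolding sesquilinear_on_def by blast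
  then have "a ((u - v) + v) w = a (u - v) w + a v w" "a w ((u - v) + v) = a w (u - v) + a w v"
    using assms unfolding sesquilinear_on_def by blast+
  then show "a (u - v) w = a u w - a v w" "a w (u - v) = a w u - a w v"
    by simp_all
qed

lemma sesquilinear_on_sum:
  assumes ses: "sesquilinear_on V a" and V: "v \<in> V" "\<And>k. f k \<in> V"
  shows "a (\<Sum>k\<in>A. c k *\<^sub>C f k) v = (\<Sum>k\<in>A. c k * a (f k) v)"
    and "a v (\<Sum>k\<in>A. c k *\<^sub>C f k) = (\<Sum>k\<in>A. cnj (c k) * a v (f k))"
proof -
  have sub: "cvec.subspace V"
    using ses unfolding sesquilinear_on_def by blast
  have cf: "c k *\<^sub>C f k \<in> V" for k
    using cvec.subspace_scale[OF sub V(2)] .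
  have sums: "(\<Sum>k\<in>B. c k *\<^sub>C f k) \<in> V" for B
    by (rule cvec.subspace_sum[OF sub]) (rule cf)
  show "a (\<Sum>k\<in>A. c k *\<^sub>C f k) v = (\<Sum>k\<in>A. c k * a (f k) v)"
  proof (induction A rule: infinite_finite_induct)
    case (insert x F)
    then show ?case
      using ses V cf[of x] sums[of F] unfolding sesquilinear_on_def by simp
  qed (use sesquilinear_on_zero[OF ses V(1)] in auto)
  show "a v (\<Sum>k\<in>A. c k *\<^sub>C f k) = (\<Sum>k\<in>A. cnj (c k) * a v (f k))"
  proof (induction A rule: infinite_finite_induct)
    case (insert x F)
    then show ?case
      using ses V cf[of x] sums[of F] unfolding sesquilinear_on_def by simp
  qed (use sesquilinear_on_zero[OF ses V(1)] in auto)
qed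

text \<open>The operator enters through \<open>a_diag\<close>: its eigenvalues
  \<open>\<nu> k\<close> are the diagonal values of \<open>a\<close>.\<close>

locale diagonal_form = hilbert_basis e
  for e :: "nat \<Rightarrow> 'h::complex_hilbert" +
  fixes V :: "'h set" and a b :: "'h \<Rightarrow> 'h \<Rightarrow> complex" and \<nu> :: "nat \<Rightarrow> real"
  assumes a_ses: "sesquilinear_on V a" and a_closed: "closed_form_on V a"
    and a_nonneg: "u \<in> V \<Longrightarrow> 0 \<le> Re (a u u)"
    and e_in: "e k \<in> V"
    and a_diag: "a (e j) (e k) = (if j = k then complex_of_real (\<nu> j) else 0)"
    and b_ses: "sesquilinear_on V b" and b_bounded: "form_bounded_on V a b"
begin

lemma subspace_V: "cvec.subspace V"
  using a_ses unfolding sesquilinear_on_def by blast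

lemma sum_in: "(\<Sum>k\<in>A. c k *\<^sub>C e k) \<in> V"
  by (rule cvec.subspace_sum[OF subspace_V]) (rule cvec.subspace_scale[OF subspace_V e_in])

lemma eigenvalue_nonneg: "0 \<le> \<nu> k"
  using a_nonneg[OF e_in[of k]] by (simp add: a_diag)

lemma form_norm_nonneg: "u \<in> V \<Longrightarrow> 0 \<le> form_norm a u"
  using a_nonneg by (simp add: form_norm_def)

lemma norm_le_form_norm: "u \<in> V \<Longrightarrow> norm u \<le> form_norm a u"
  using a_nonneg by (auto simp: form_norm_def intro: real_le_rsqrt)

lemma form_norm_sum:
  assumes "finite A"
  shows "form_norm a (\<Sum>k\<in>A. c k *\<^sub>C e k) = sqrt (\<Sum>k\<in>A. (\<nu> k + 1) * (cmod (c k))\<^sup>2)"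
proof -
  let ?s = "\<Sum>k\<in>A. c k *\<^sub>C e k"
  have *: "a (e j) ?s = (if j \<in> A then cnj (c j) * \<nu> j else 0)" for j
    using assms by (simp add: sesquilinear_on_sum(2)[OF a_ses e_in e_in] a_diag if_distrib cong: if_cong)
  have "a ?s ?s = (\<Sum>k\<in>A. c k * a (e k) ?s)"
    by (rule sesquilinear_on_sum(1)[OF a_ses sum_in e_in])
  also have "\<dots> = (\<Sum>k\<in>A. complex_of_real (\<nu> k * (cmod (c k))\<^sup>2))"
    by (rule sum.cong) (auto simp: * cmod_power2_eq mult_ac)
  finally have "Re (a ?s ?s) = (\<Sum>k\<in>A. \<nu> k * (cmod (c k))\<^sup>2)"
    by simp
  then show ?thesis
    by (simp add: form_norm_def norm_sum_basis[OF assms] sum.distrib algebra_simps)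
qed

text \<open>The partial sums are Cauchy in the form norm, so closedness yields a limit in
  \<open>V\<close>. The form norm dominates the norm, so this limit is the sum of the series in the
  Hilbert space.\<close>

lemma form_norm_series:
  assumes sq: "summable (\<lambda>k. (\<nu> k + 1) * (cmod (c k))\<^sup>2)"
  shows "(\<Sum>k. c k *\<^sub>C e k) \<in> V"
    and "(\<lambda>n. form_norm a ((\<Sum>k<n. c k *\<^sub>C e k) - (\<Sum>k. c k *\<^sub>C e k))) \<longlonglongrightarrow> 0"
proof -
  define s where "s n = (\<Sum>k<n. c k *\<^sub>C e k)" for n
  have s_in: "s n \<in> V" for n
    by (simp add: s_def sum_in)
  \<comment> \<open>\<open>min\<close> and \<open>max\<close> treat both orders of the indices at
    once; the absolute value matches the norm in the Cauchy criterion.\<close>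
  have diff: "form_norm a (s m - s n) =
      sqrt (\<bar>\<Sum>k\<in>{min m n..<max m n}. (\<nu> k + 1) * (cmod (c k))\<^sup>2\<bar>)" for m n
  proof -
    have pos: "0 \<le> (\<Sum>k\<in>A. (\<nu> k + 1) * (cmod (c k))\<^sup>2)" for A
      by (intro sum_nonneg) (simp add: eigenvalue_nonneg)
    have le: "form_norm a (s n - s m) = sqrt (\<Sum>k\<in>{m..<n}. (\<nu> k + 1) * (cmod (c k))\<^sup>2)"
      if "m \<le> n" for m n
      using sum_diff_nat_ivl[of 0 m n "\<lambda>k. c k *\<^sub>C e k"] that
      by (simp add: s_def lessThan_atLeast0 flip: form_norm_sum)
    have "form_norm a (- u) = form_norm a u" if "u \<in> V" for u
    proof -
      have "- u \<in> V"
        using cvec.subspace_neg[OF subspace_V that] .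
      then have "a (- u) (- u) = a u u"
        using sesquilinear_on_diff[OF a_ses cvec.subspace_0[OF subspace_V] that, of "- u"]
          sesquilinear_on_diff(2)[OF a_ses cvec.subspace_0[OF subspace_V] that that]
          sesquilinear_on_zero[OF a_ses that] sesquilinear_on_zero[OF a_ses, of "- u"]
        by simp
      then show ?thesis
        by (simp add: form_norm_def)
    qed
    from this[of "s m - s n"] have "form_norm a (s n - s m) = form_norm a (s m - s n)"
      using cvec.subspace_diff[OF subspace_V s_in s_in] by simp
    then show ?thesis
      using le[of m n] le[of n m] pos by (cases "m \<le> n") (auto simp: min_def max_def)
  qed
  have "\<exists>N. \<forall>m\<ge>N. \<forall>n\<ge>N. form_norm a (s m - s n) < r" if "r > 0" for r
  proof -
    have "r\<^sup>2 > 0"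
      using that by simp
    then obtain N where "\<And>m n. m \<ge> N \<Longrightarrow> norm (\<Sum>k\<in>{m..<n}. (\<nu> k + 1) * (cmod (c k))\<^sup>2) < r\<^sup>2"
      using sq[unfolded summable_Cauchy] by blast
    then have "form_norm a (s m - s n) < r" if "m \<ge> N" "n \<ge> N" for m n
      using that \<open>r > 0\<close> unfolding diff by (intro real_less_lsqrt) auto
    then show ?thesis
      by blast
  qed
  then obtain u where u: "u \<in> V" "(\<lambda>n. form_norm a (s n - u)) \<longlonglongrightarrow> 0"
    using a_closed[unfolded closed_form_on_def, rule_format, of s] s_in by blast
  have "(\<lambda>n. s n - u) \<longlonglongrightarrow> 0"
    using u(2) by (rule Lim_null_comparison[rotated])
      (use norm_le_form_norm cvec.subspace_diff[OF subspace_V s_in u(1)] in auto)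
  then have "s \<longlonglongrightarrow> u"
    using Lim_null by blast
  then have "(\<lambda>k. c k *\<^sub>C e k) sums u"
    unfolding sums_def s_def .
  then have "u = (\<Sum>k. c k *\<^sub>C e k)"
    by (simp add: sums_iff)
  then show "(\<Sum>k. c k *\<^sub>C e k) \<in> V"
    "(\<lambda>n. form_norm a ((\<Sum>k<n. c k *\<^sub>C e k) - (\<Sum>k. c k *\<^sub>C e k))) \<longlonglongrightarrow> 0"
    using u by (simp_all add: s_def)
qed

text \<open>\<open>b\<close> is continuous only for the form norm, so the termwise evaluation rests
  on convergence in that norm.\<close>

lemma b_series:
  assumes sq: "summable (\<lambda>k. (\<nu> k + 1) * (cmod (c k))\<^sup>2)" and v: "v \<in> V"
  shows "(\<lambda>k. c k * b (e k) v) sums b (\<Sum>k. c k *\<^sub>C e k) v"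
    and "(\<lambda>k. cnj (c k) * b v (e k)) sums b v (\<Sum>k. c k *\<^sub>C e k)"
proof -
  obtain C where C: "cmod (b u v) \<le> C * form_norm a u * form_norm a v" if "u \<in> V" "v \<in> V" for u v
    using b_bounded unfolding form_bounded_on_def by blast
  let ?u = "\<Sum>k. c k *\<^sub>C e k" and ?s = "\<lambda>n. \<Sum>k<n. c k *\<^sub>C e k"
  note u = form_norm_series[OF sq]
  have d_in: "?s n - ?u \<in> V" for n
    using cvec.subspace_diff[OF subspace_V sum_in u(1)] .
  have "(\<lambda>n. C * form_norm a (?s n - ?u) * form_norm a v) \<longlonglongrightarrow> C * 0 * form_norm a v"
    by (intro tendsto_intros u)
  then have lim: "(\<lambda>n. C * form_norm a (?s n - ?u) * form_norm a v) \<longlonglongrightarrow> 0"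
    by simp
  have "(\<lambda>n. b (?s n) v - b ?u v) \<longlonglongrightarrow> 0"
    using lim by (rule Lim_null_comparison[rotated])
      (use C[OF d_in v] in \<open>simp add: sesquilinear_on_diff[OF b_ses sum_in u(1) v]\<close>)
  then show "(\<lambda>k. c k * b (e k) v) sums b ?u v"
    unfolding sums_def sesquilinear_on_sum(1)[OF b_ses v e_in] by (simp add: LIM_zero_cancel)
  have "(\<lambda>n. b v (?s n) - b v ?u) \<longlonglongrightarrow> 0"
    using lim by (rule Lim_null_comparison[rotated])
      (use C[OF v d_in] in \<open>simp add: sesquilinear_on_diff[OF b_ses sum_in u(1) v] mult_ac\<close>)
  then show "(\<lambda>k. cnj (c k) * b v (e k)) sums b v ?u"
    unfolding sums_def sesquilinear_on_sum(2)[OF b_ses v e_in] by (simp add: LIM_zero_cancel)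
qed

text \<open>The bound holds for partial sums, and the limit is taken in one argument after the
  other. The constant does not depend on the coefficients.\<close>

lemma b_series_bounded:
  obtains C where "\<And>c d. summable (\<lambda>k. (\<nu> k + 1) * (cmod (c k))\<^sup>2) \<Longrightarrow>
      summable (\<lambda>k. (\<nu> k + 1) * (cmod (d k))\<^sup>2) \<Longrightarrow>
      cmod (b (\<Sum>k. c k *\<^sub>C e k) (\<Sum>k. d k *\<^sub>C e k)) \<le>
        C * sqrt (\<Sum>k. (\<nu> k + 1) * (cmod (c k))\<^sup>2) * sqrt (\<Sum>k. (\<nu> k + 1) * (cmod (d k))\<^sup>2)"
    and "C \<ge> 0"
proof -
  obtain C where C: "cmod (b u v) \<le> C * form_norm a u * form_norm a v" if "u \<in> V" "v \<in> V" for u v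
    using b_bounded unfolding form_bounded_on_def by blast
  show thesis
  \<comment> \<open>The constant in \<open>form_bounded_on\<close> carries no sign.\<close>
  proof (rule that[of "\<bar>C\<bar>"])
    fix c d :: "nat \<Rightarrow> complex"
    assume c: "summable (\<lambda>k. (\<nu> k + 1) * (cmod (c k))\<^sup>2)"
      and d: "summable (\<lambda>k. (\<nu> k + 1) * (cmod (d k))\<^sup>2)"
    let ?P = "sqrt (\<Sum>k. (\<nu> k + 1) * (cmod (c k))\<^sup>2)"
    let ?Q = "sqrt (\<Sum>k. (\<nu> k + 1) * (cmod (d k))\<^sup>2)"
    let ?s = "\<lambda>n. \<Sum>k<n. c k *\<^sub>C e k" and ?t = "\<lambda>n. \<Sum>k<n. d k *\<^sub>C e k"
    let ?u = "\<Sum>k. c k *\<^sub>C e k" and ?v = "\<Sum>k. d k *\<^sub>C e k"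
    have partial: "form_norm a (\<Sum>k<n. f k *\<^sub>C e k) \<le> sqrt (\<Sum>k. (\<nu> k + 1) * (cmod (f k))\<^sup>2)"
      if "summable (\<lambda>k. (\<nu> k + 1) * (cmod (f k))\<^sup>2)" for f n
      using that by (auto simp: form_norm_sum eigenvalue_nonneg intro!: sum_le_suminf)
    have st: "cmod (b (?s n) (?t m)) \<le> \<bar>C\<bar> * ?P * ?Q" for n m
    proof -
      have "cmod (b (?s n) (?t m)) \<le> C * (form_norm a (?s n) * form_norm a (?t m))"
        using C[OF sum_in sum_in] by (simp add: mult.assoc)
      also have "\<dots> \<le> \<bar>C\<bar> * (?P * ?Q)"
      proof (rule mult_mono)
        show "form_norm a (?s n) * form_norm a (?t m) \<le> ?P * ?Q"
          by (rule mult_mono') (intro partial c d form_norm_nonneg sum_in)+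
      qed (auto intro!: mult_nonneg_nonneg form_norm_nonneg sum_in)
      finally show ?thesis
        by (simp add: mult.assoc)
    qed
    have "(\<lambda>n. b (?s n) (?t m)) \<longlonglongrightarrow> b ?u (?t m)" for m
      using b_series(1)[OF c sum_in] unfolding sums_def sesquilinear_on_sum(1)[OF b_ses sum_in e_in] .
    then have ut: "cmod (b ?u (?t m)) \<le> \<bar>C\<bar> * ?P * ?Q" for m
      by (rule Lim_bounded[OF tendsto_norm]) (use st in blast)
    have "(\<lambda>m. b ?u (?t m)) \<longlonglongrightarrow> b ?u ?v"
      using b_series(2)[OF d form_norm_series(1)[OF c]]
      unfolding sums_def sesquilinear_on_sum(2)[OF b_ses form_norm_series(1)[OF c] e_in] .
    then show "cmod (b ?u ?v) \<le> \<bar>C\<bar> * ?P * ?Q"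
      by (rule Lim_bounded[OF tendsto_norm]) (use ut in blast)
  qed simp
qed

end

section \<open>The operators \<open>K(z)\<close> and \<open>B(z)\<close>\<close>

text \<open>The modulus of a real power depends only on the modulus of the base, so the branch cut
  has no influence; for \<open>w = 0\<close> both sides are 0.\<close>

lemma cmod_powr_neg_half: "(cmod (w powr (- 1 / 2)))\<^sup>2 = 1 / cmod w"
proof -
  have "cmod (w powr (- 1 / 2)) = cmod w powr (- 1 / 2)"
    using norm_powr_real_powr'[of "- 1 / 2 :: complex" w] by simp
  moreover have "(cmod w powr (- 1 / 2))\<^sup>2 = cmod w powr (- 1)"
    by (simp add: power2_eq_square flip: powr_add)
  ultimately show ?thesis
    by (simp add: powr_minus_divide)
qed

text \<open>\<open>\<delta>\<close> makes the operators at \<open>z\<close> bounded and well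
  defined. It does not appear in the quantitative estimates below, which use the finer bounds
  \<open>\<rho> k\<close>.\<close>

locale perturbation_at = diagonal_form e V a b \<nu>
  for e :: "nat \<Rightarrow> 'h::complex_hilbert" and V a b \<nu> +
  fixes z :: complex and \<delta> :: real
  assumes \<delta>_pos: "\<delta> > 0" and \<delta>_le: "\<delta> \<le> cmod (z - complex_of_real (\<nu> k))"
begin

definition kern :: "nat \<Rightarrow> complex" where
  "kern k = (z - complex_of_real (\<nu> k)) powr (- 1 / 2)"

abbreviation K :: "'h \<Rightarrow> 'h" where
  "K \<equiv> diag_op kern"

abbreviation K' :: "'h \<Rightarrow> 'h" where
  "K' \<equiv> diag_op (\<lambda>k. cnj (kern k))"

definition B :: "'h \<Rightarrow> 'h" where
  "B = (THE T. bounded_clinear T \<and> (\<forall>u v. cinner (T u) v = b (K u) (hilbert_adjoint K v)))"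

lemma kern_sq: "(cmod (kern k))\<^sup>2 = 1 / cmod (z - complex_of_real (\<nu> k))"
  unfolding kern_def by (rule cmod_powr_neg_half)

lemma kern_bound: "cmod (kern k) \<le> sqrt (1 / \<delta>)"
  using \<delta>_pos \<delta>_le[of k] by (intro real_le_rsqrt) (auto simp: kern_sq frac_le)

lemma kern_cnj_bound: "cmod (cnj (kern k)) \<le> sqrt (1 / \<delta>)"
  using kern_bound by simp

text \<open>An eigenvalue exceeds its distance to \<open>z\<close> by at most \<open>cmod z\<close>.
  Hence the inverse square root gains exactly what the form norm costs, and \<open>K\<close> maps
  the whole space boundedly into \<open>V\<close>.\<close>

lemma kern_form_bound: "(\<nu> k + 1) * (cmod (kern k))\<^sup>2 \<le> 1 + (cmod z + 1) / \<delta>"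
proof -
  let ?r = "cmod (z - complex_of_real (\<nu> k))"
  have r: "?r > 0"
    using \<delta>_pos \<delta>_le[of k] by linarith
  have "cmod (complex_of_real (\<nu> k)) \<le> cmod z + ?r"
    by (metis norm_triangle_sub norm_minus_commute)
  then have "(\<nu> k + 1) / ?r \<le> (?r + (cmod z + 1)) / ?r"
    using eigenvalue_nonneg[of k] r by (intro divide_right_mono) auto
  also have "\<dots> = 1 + (cmod z + 1) / ?r"
    using r by (simp add: field_simps)
  also have "\<dots> \<le> 1 + (cmod z + 1) / \<delta>"
    using \<delta>_pos \<delta>_le[of k] r by (intro add_left_mono divide_left_mono mult_pos_pos) auto
  finally show ?thesis
    by (simp add: kern_sq)
qed

text \<open>Only the modulus of \<open>l\<close> is prescribed, so that \<open>K\<close> and its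
  adjoint \<open>K'\<close> are covered together.\<close>

lemma diag_form_summable:
  assumes "\<And>k. cmod (l k) = cmod (kern k)"
  shows "summable (\<lambda>k. (\<nu> k + 1) * (cmod (l k * cinner u (e k)))\<^sup>2)"
    and "(\<Sum>k. (\<nu> k + 1) * (cmod (l k * cinner u (e k)))\<^sup>2) \<le> (1 + (cmod z + 1) / \<delta>) * (norm u)\<^sup>2"
proof -
  let ?R = "1 + (cmod z + 1) / \<delta>"
  have le: "(\<nu> k + 1) * (cmod (l k * cinner u (e k)))\<^sup>2 \<le> ?R * (cmod (cinner u (e k)))\<^sup>2" for k
    using mult_right_mono[OF kern_form_bound[of k], of "(cmod (cinner u (e k)))\<^sup>2"]
    by (simp add: norm_mult power_mult_distrib assms mult.assoc)
  have R: "(\<lambda>k. ?R * (cmod (cinner u (e k)))\<^sup>2) sums (?R * (norm u)\<^sup>2)"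
    by (intro sums_mult parseval)
  show *: "summable (\<lambda>k. (\<nu> k + 1) * (cmod (l k * cinner u (e k)))\<^sup>2)"
    by (rule summable_comparison_test'[OF sums_summable[OF R]]) (use le eigenvalue_nonneg in auto)
  show "(\<Sum>k. (\<nu> k + 1) * (cmod (l k * cinner u (e k)))\<^sup>2) \<le> ?R * (norm u)\<^sup>2"
    unfolding sums_unique[OF R] by (rule suminf_le[OF le * sums_summable[OF R]])
qed

lemma K_in: "K u \<in> V" and K'_in: "K' u \<in> V"
  unfolding diag_op_def by (rule form_norm_series(1)[OF diag_form_summable(1)]; simp)+

lemma K_lin: "K (u + v) = K u + K v" "K (c *\<^sub>C u) = c *\<^sub>C K u"
  using bounded_clinear_diag_op[of kern, OF kern_bound] linear_add[OF bounded_linear.linear, of K]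
  unfolding bounded_clinear_def by auto

lemma K'_lin: "K' (u + v) = K' u + K' v" "K' (c *\<^sub>C u) = c *\<^sub>C K' u"
  using bounded_clinear_diag_op[of "\<lambda>k. cnj (kern k)", OF kern_cnj_bound]
    linear_add[OF bounded_linear.linear, of K']
  unfolding bounded_clinear_def by auto

text \<open>Boundedness of \<open>K\<close> and \<open>K'\<close> into \<open>V\<close> turns the
  form bound of \<open>b\<close> into a bound in the Hilbert space norm, so the operator described
  by \<open>B\<close> exists.\<close>

lemma cinner_B: "cinner (B u) v = b (K u) (K' v)"
proof -
  obtain C where C: "\<And>c d. summable (\<lambda>k. (\<nu> k + 1) * (cmod (c k))\<^sup>2) \<Longrightarrow>
      summable (\<lambda>k. (\<nu> k + 1) * (cmod (d k))\<^sup>2) \<Longrightarrow>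
      cmod (b (\<Sum>k. c k *\<^sub>C e k) (\<Sum>k. d k *\<^sub>C e k)) \<le>
        C * sqrt (\<Sum>k. (\<nu> k + 1) * (cmod (c k))\<^sup>2) * sqrt (\<Sum>k. (\<nu> k + 1) * (cmod (d k))\<^sup>2)"
    and C_nonneg: "C \<ge> 0"
    using b_series_bounded by blast
  define R where "R = 1 + (cmod z + 1) / \<delta>"
  have R: "R \<ge> 0"
    using \<delta>_pos by (simp add: R_def)
  have bound: "cmod (b (K u) (K' v)) \<le> C * R * norm u * norm v" for u v
  proof -
    have le: "sqrt (\<Sum>k. (\<nu> k + 1) * (cmod (l k * cinner u (e k)))\<^sup>2) \<le> sqrt R * norm u"
      if "\<And>k. cmod (l k) = cmod (kern k)" for l u
    proof -
      have "sqrt (\<Sum>k. (\<nu> k + 1) * (cmod (l k * cinner u (e k)))\<^sup>2) \<le> sqrt (R * (norm u)\<^sup>2)"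
        unfolding R_def by (intro real_sqrt_le_mono diag_form_summable that)
      then show ?thesis
        by (simp add: real_sqrt_mult)
    qed
    have "cmod (b (K u) (K' v)) \<le> C * (sqrt (\<Sum>k. (\<nu> k + 1) * (cmod (kern k * cinner u (e k)))\<^sup>2) *
        sqrt (\<Sum>k. (\<nu> k + 1) * (cmod (cnj (kern k) * cinner v (e k)))\<^sup>2))"
      unfolding diag_op_def mult.assoc[symmetric, of C]
      by (rule C[OF diag_form_summable(1) diag_form_summable(1)]) simp_all
    also have "\<dots> \<le> C * ((sqrt R * norm u) * (sqrt R * norm v))"
      using R by (intro mult_left_mono[OF mult_mono'] le C_nonneg real_sqrt_ge_zero suminf_nonneg
          diag_form_summable) (auto simp: eigenvalue_nonneg)
    also have "\<dots> = C * (sqrt R * sqrt R) * norm u * norm v"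
      by (simp only: mult_ac)
    finally show ?thesis
      using R by simp
  qed
  have "\<exists>!T. bounded_clinear T \<and> (\<forall>u v. cinner (T u) v = b (K u) (K' v))"
  proof (rule bounded_form_operator[OF _ _ _ _ bound])
    show "b (K (u + v)) (K' w) = b (K u) (K' w) + b (K v) (K' w)" for u v w
      using b_ses K_in K'_in unfolding K_lin sesquilinear_on_def by blast
    show "b (K (c *\<^sub>C u)) (K' w) = c * b (K u) (K' w)" for c u w
      using b_ses K_in K'_in unfolding K_lin sesquilinear_on_def by blast
    show "b (K u) (K' (v + w)) = b (K u) (K' v) + b (K u) (K' w)" for u v w
      using b_ses K_in K'_in unfolding K'_lin sesquilinear_on_def by blast
    show "b (K u) (K' (c *\<^sub>C w)) = cnj c * b (K u) (K' w)" for c u w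
      using b_ses K_in K'_in unfolding K'_lin sesquilinear_on_def by blast
  qed
  from theI'[OF this] show ?thesis
    unfolding B_def hilbert_adjoint_diag_op[OF kern_bound] by blast
qed

lemma cinner_B_basis: "cinner (B u) (e m) = kern m * b (K u) (e m)"
  using b_ses K_in[of u] e_in[of m]
  by (simp add: cinner_B diag_op_basis[OF kern_cnj_bound] sesquilinear_on_def)

lemma b_K_sums: "(\<lambda>k. kern k * cinner u (e k) * b (e k) (e m)) sums b (K u) (e m)"
  unfolding diag_op_def by (rule b_series(1)[OF diag_form_summable(1) e_in]) simp

text \<open>\<open>w k\<close> abstracts the decay \<open>real (Suc k) powr (- \<alpha>)\<close>,
  and \<open>\<rho> k\<close> an explicit lower bound for the distance of \<open>z\<close> to the
  spectrum.\<close>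

context
  fixes M :: real and w \<rho> :: "nat \<Rightarrow> real"
  assumes M: "M \<ge> 0" and w: "\<And>k. w k \<ge> 0"
    and b_bound: "\<And>l m. cmod (b (e l) (e m)) \<le> M * w l * w m"
    and \<rho>: "\<And>k. 0 < \<rho> k" "\<And>k. \<rho> k \<le> cmod (z - complex_of_real (\<nu> k))"
begin

lemma kern_sq_le: "(cmod (kern k))\<^sup>2 \<le> 1 / \<rho> k"
  unfolding kern_sq using \<rho>[of k] by (intro frac_le) auto

text \<open>The shape \<open>X * w l * cmod (kern l)\<close> reproduces itself: pairing it with a
  row of the matrix of \<open>B\<close> produces
  \<open>(w l)\<^sup>2 * (cmod (kern l))\<^sup>2\<close>, whose sum over \<open>l\<close> is the new
  factor.\<close>

lemma B_coeff_step:
  assumes v: "\<And>l. cmod (cinner v (e l)) \<le> X * w l * cmod (kern l)" and X: "X \<ge> 0"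
    and S: "summable (\<lambda>l. (w l)\<^sup>2 / \<rho> l)"
  shows "cmod (cinner (B v) (e m)) \<le> X * (M * (\<Sum>l. (w l)\<^sup>2 / \<rho> l)) * w m * cmod (kern m)"
proof -
  have le: "cmod (kern l * cinner v (e l) * b (e l) (e m)) \<le> X * M * w m * ((w l)\<^sup>2 / \<rho> l)" for l
  proof -
    have "cmod (kern l * cinner v (e l) * b (e l) (e m)) \<le>
        cmod (kern l) * (X * w l * cmod (kern l)) * (M * w l * w m)"
      unfolding norm_mult using M X w by (intro mult_mono v b_bound order_refl mult_nonneg_nonneg) auto
    also have "\<dots> = X * M * w m * ((w l)\<^sup>2 * (cmod (kern l))\<^sup>2)"
      by (simp add: power2_eq_square)
    also have "\<dots> \<le> X * M * w m * ((w l)\<^sup>2 * (1 / \<rho> l))"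
      using X M w by (intro mult_left_mono kern_sq_le) auto
    finally show ?thesis
      by simp
  qed
  have "cmod (b (K v) (e m)) \<le> (\<Sum>l. X * M * w m * ((w l)\<^sup>2 / \<rho> l))"
    unfolding sums_unique[OF b_K_sums] by (rule norm_suminf_le[OF le summable_mult[OF S]])
  also have "\<dots> = X * (M * (\<Sum>l. (w l)\<^sup>2 / \<rho> l)) * w m"
    unfolding suminf_mult[OF S] by (simp only: mult_ac)
  finally show ?thesis
    unfolding cinner_B_basis norm_mult by (subst mult.commute) (rule mult_right_mono, simp_all)
qed

text \<open>Applied to a single basis vector, \<open>B\<close> involves one matrix column and no
  series. This is why the first-order term gets by with the weaker exponent condition.\<close>

lemma B_coeff_start:
  "cmod (cinner (B (K (e n))) (e m)) \<le> (M * w n / \<rho> n) * w m * cmod (kern m)"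
proof -
  have "K (K (e n)) = (kern n * kern n) *\<^sub>C e n"
    by (simp add: diag_op_basis[OF kern_bound] K_lin)
  then have "b (K (K (e n))) (e m) = kern n * kern n * b (e n) (e m)"
    using b_ses e_in unfolding sesquilinear_on_def by simp
  then have "cmod (b (K (K (e n))) (e m)) = (cmod (kern n))\<^sup>2 * cmod (b (e n) (e m))"
    by (simp add: norm_mult power2_eq_square)
  also have "\<dots> \<le> (1 / \<rho> n) * (M * w n * w m)"
    using \<rho>(1)[of n] by (intro mult_mono kern_sq_le b_bound) auto
  finally show ?thesis
    unfolding cinner_B_basis norm_mult by (subst mult.commute) (rule mult_right_mono, simp_all)
qed

text \<open>For \<open>k = 0\<close> the power of the possibly divergent series is 1, hence the
  disjunction in \<open>S\<close>.\<close>

lemma B_coeff_iterate: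
  assumes S: "k = 0 \<or> summable (\<lambda>l. (w l)\<^sup>2 / \<rho> l)"
  shows "cmod (cinner ((B ^^ Suc k) (K (e n))) (e m)) \<le>
    (M * w n / \<rho> n) * (M * (\<Sum>l. (w l)\<^sup>2 / \<rho> l)) ^ k * w m * cmod (kern m)"
  using S
proof (induction k arbitrary: m)
  case 0
  then show ?case
    using B_coeff_start by simp
next
  case (Suc k)
  then have S: "summable (\<lambda>l. (w l)\<^sup>2 / \<rho> l)"
    by simp
  let ?S = "\<Sum>l. (w l)\<^sup>2 / \<rho> l"
  have nonneg: "0 \<le> (M * w n / \<rho> n) * (M * ?S) ^ k"
    using M w \<rho>(1) suminf_nonneg[OF S] by (simp add: less_imp_le)
  have "cmod (cinner (B ((B ^^ Suc k) (K (e n)))) (e m)) \<le>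
      ((M * w n / \<rho> n) * (M * ?S) ^ k) * (M * ?S) * w m * cmod (kern m)"
    using Suc.IH S by (intro B_coeff_step nonneg) auto
  then show ?case
    by (simp add: mult_ac)
qed

text \<open>The last \<open>K\<close> contributes a second factor \<open>kern l\<close>, so the
  coordinates are bounded by \<open>X * (w l / \<rho> l)\<close>; Parseval turns this into the
  square-sum.\<close>

lemma norm_K_le:
  assumes v: "\<And>l. cmod (cinner v (e l)) \<le> X * w l * cmod (kern l)" and X: "X \<ge> 0"
    and T: "summable (\<lambda>l. (w l)\<^sup>2 / (\<rho> l)\<^sup>2)"
  shows "norm (K v) \<le> X * sqrt (\<Sum>l. (w l)\<^sup>2 / (\<rho> l)\<^sup>2)"
proof -
  have "norm (K v) \<le> sqrt (\<Sum>l. (X * (w l / \<rho> l))\<^sup>2)"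
  proof (rule norm_le_coeffs)
    fix l
    have "cmod (cinner (K v) (e l)) = cmod (kern l) * cmod (cinner v (e l))"
      by (simp add: cinner_diag_op[OF kern_bound] norm_mult)
    also have "\<dots> \<le> cmod (kern l) * (X * w l * cmod (kern l))"
      by (intro mult_left_mono v) auto
    also have "\<dots> = X * w l * (cmod (kern l))\<^sup>2"
      by (simp add: power2_eq_square)
    also have "\<dots> \<le> X * w l * (1 / \<rho> l)"
      using X w by (intro mult_left_mono kern_sq_le) auto
    finally show "cmod (cinner (K v) (e l)) \<le> X * (w l / \<rho> l)"
      by simp
    show "summable (\<lambda>l. (X * (w l / \<rho> l))\<^sup>2)"
      unfolding power_mult_distrib power_divide by (rule summable_mult[OF T])
  qed
  also have "(\<Sum>l. (X * (w l / \<rho> l))\<^sup>2) = X\<^sup>2 * (\<Sum>l. (w l)\<^sup>2 / (\<rho> l)\<^sup>2)"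
    unfolding power_mult_distrib power_divide by (rule suminf_mult[OF T])
  finally show ?thesis
    using X by (simp add: real_sqrt_mult)
qed

lemma norm_KBK_le:
  assumes S: "k = 0 \<or> summable (\<lambda>l. (w l)\<^sup>2 / \<rho> l)"
    and T: "summable (\<lambda>l. (w l)\<^sup>2 / (\<rho> l)\<^sup>2)"
  shows "norm (K ((B ^^ Suc k) (K (e n)))) \<le>
    (M * w n / \<rho> n) * (M * (\<Sum>l. (w l)\<^sup>2 / \<rho> l)) ^ k * sqrt (\<Sum>l. (w l)\<^sup>2 / (\<rho> l)\<^sup>2)"
proof (rule norm_K_le[OF B_coeff_iterate[OF S] _ T])
  have "0 \<le> (M * (\<Sum>l. (w l)\<^sup>2 / \<rho> l)) ^ k"
    using S M \<rho>(1)
    by (cases "k = 0")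
      (auto intro!: zero_le_power mult_nonneg_nonneg suminf_nonneg divide_nonneg_nonneg w
        simp: less_imp_le)
  then show "0 \<le> (M * w n / \<rho> n) * (M * (\<Sum>l. (w l)\<^sup>2 / \<rho> l)) ^ k"
    using M w \<rho>(1) by (simp add: less_imp_le)
qed

end

end

section \<open>Sums of powers\<close>

text \<open>Mean value theorem for \<open>t powr (1 - s)\<close> between \<open>x - 1\<close> and
  \<open>x\<close>.\<close>

lemma powr_minus_le_telescope:
  assumes "s > 1" "x > (1::real)"
  shows "x powr (-s) \<le> ((x - 1) powr (1 - s) - x powr (1 - s)) / (s - 1)"
proof -
  have "\<exists>t. x - 1 < t \<and> t < x \<and> x powr (1 - s) - (x - 1) powr (1 - s) =
      (x - (x - 1)) * ((1 - s) * t powr (1 - s - 1))"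
    using assms by (intro MVT2 has_real_derivative_powr) auto
  then obtain t where t: "x - 1 < t" "t < x"
      "x powr (1 - s) - (x - 1) powr (1 - s) = (1 - s) * t powr (-s)"
    by auto
  then have "(s - 1) * t powr (-s) = (x - 1) powr (1 - s) - x powr (1 - s)"
    by (simp add: algebra_simps)
  moreover have "x powr (-s) \<le> t powr (-s)"
    using t assms by (intro powr_mono2') auto
  then have "(s - 1) * x powr (-s) \<le> (s - 1) * t powr (-s)"
    using assms by (intro mult_left_mono) auto
  ultimately show ?thesis
    using assms by (simp add: field_simps)
qed

lemma sum_powr_tail:
  assumes "s > 1" "n \<ge> 1"
  shows "(\<Sum>m\<in>{n<..N}. real m powr (-s)) \<le> real n powr (1 - s) / (s - 1)"
proof -
  \<comment> \<open>With \<open>max n N\<close> the claim also holds for \<open>N \<le> n\<close>,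
    where both sides vanish, and the induction can start at 0.\<close>
  have "(\<Sum>m\<in>{n<..N}. real m powr (-s)) \<le> (real n powr (1 - s) - real (max n N) powr (1 - s)) / (s - 1)"
  proof (induction N)
    case (Suc N)
    show ?case
    proof (cases "n \<le> N")
      case True
      then have "{n<..Suc N} = insert (Suc N) {n<..N}"
        by auto
      moreover have "real (Suc N) powr (-s) \<le>
          (real N powr (1 - s) - real (Suc N) powr (1 - s)) / (s - 1)"
        using powr_minus_le_telescope[of s "real (Suc N)"] assms True by simp
      ultimately show ?thesis
        using Suc True by (simp add: max_def diff_divide_distrib)
    qed (use assms in auto)
  qed (use assms in auto)
  also have "\<dots> \<le> real n powr (1 - s) / (s - 1)"
    using assms by (intro divide_right_mono) auto
  finally show ?thesis .
qed

text \<open>Partial sums of the zeta series, kept unevaluated so that convergent, logarithmic and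
  divergent exponents can be treated alike.\<close>

definition power_sum :: "real \<Rightarrow> nat \<Rightarrow> real" where
  "power_sum s n = (\<Sum>m=1..n. real m powr (-s))"

lemma power_sum_ge_1: "n \<ge> 1 \<Longrightarrow> power_sum s n \<ge> 1"
  using member_le_sum[of 1 "{1..n}" "\<lambda>m. real m powr (-s)"] by (simp add: power_sum_def)

lemma power_sum_bounded:
  assumes "s > 1" "n \<ge> 1"
  shows "power_sum s n \<le> 1 + 1 / (s - 1)"
proof -
  have "{1..n} = insert 1 {1<..n}"
    using assms by auto
  then show ?thesis
    using sum_powr_tail[of s 1 n] assms by (simp add: power_sum_def)
qed

text \<open>The difference of harmonic number and logarithm decreases from its value 1 at
  \<open>n = 1\<close>.\<close>

lemma power_sum_1: "n \<ge> 1 \<Longrightarrow> power_sum 1 n \<le> ln (exp 1 * real n)"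
proof -
  assume n: "n \<ge> 1"
  have "power_sum 1 n = harm n"
    by (simp add: power_sum_def harm_def powr_minus)
  moreover have "harm (Suc (n - 1)) - ln (real (Suc (n - 1))) \<le> harm (Suc 0) - ln (real (Suc 0))"
    using decseq_harm_diff_ln by (rule decseqD) simp
  ultimately show ?thesis
    using n by (simp add: ln_mult harm_def)
qed

lemma power_sum_exchange:
  assumes "s \<le> p"
  shows "power_sum s n \<le> real n powr (p - s) * power_sum p n"
  unfolding power_sum_def sum_distrib_left
proof (rule sum_mono)
  fix m assume m: "m \<in> {1..n}"
  have "real m powr (-s) = real m powr (p - s) * real m powr (-p)"
    by (simp flip: powr_add)
  also have "\<dots> \<le> real n powr (p - s) * real m powr (-p)"
    using m assms by (intro mult_right_mono powr_mono2) auto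
  finally show "real m powr (-s) \<le> real n powr (p - s) * real m powr (-p)" .
qed

lemma power_sum_exchange':
  assumes "p \<le> s"
  shows "real n powr (p - s) * power_sum p n \<le> power_sum s n"
  unfolding power_sum_def sum_distrib_left
proof (rule sum_mono)
  fix m assume m: "m \<in> {1..n}"
  have "real n powr (p - s) * real m powr (-p) \<le> real m powr (p - s) * real m powr (-p)"
    using m assms by (intro mult_right_mono powr_mono2') auto
  also have "\<dots> = real m powr (-s)"
    by (simp flip: powr_add)
  finally show "real n powr (p - s) * real m powr (-p) \<le> real m powr (-s)" .
qed

text \<open>Up to a constant, the lower bound for the distance of \<open>\<mu> m\<close> and
  \<open>\<mu> n\<close> obtained by summing the gaps between them. \<open>max 1\<close> turns the
  value at \<open>m = n\<close> into the order of the contour's half width.\<close>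

definition gap_dist :: "real \<Rightarrow> nat \<Rightarrow> nat \<Rightarrow> real" where
  "gap_dist \<gamma> n m = max 1 \<bar>real m - real n\<bar> * real (max m n) powr (\<gamma> - 1)"

lemma gap_dist_pos: "n \<ge> 1 \<Longrightarrow> gap_dist \<gamma> n m > 0"
  by (simp add: gap_dist_def)

text \<open>Common form of \<open>sigma_rate\<close> (\<open>p = 1\<close>) and
  \<open>tau_rate\<close> (\<open>p = 2\<close>), up to constants: \<open>power_sum p n\<close> is
  logarithmic for \<open>p = 1\<close> and bounded for \<open>p = 2\<close>.\<close>

definition gap_rate :: "real \<Rightarrow> real \<Rightarrow> real \<Rightarrow> nat \<Rightarrow> real" where
  "gap_rate \<omega> \<gamma> p n = (if \<omega> \<le> p then real n powr (p - \<omega> - p * \<gamma>) * power_sum p n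
     else real n powr (- (p * \<gamma>)))"

section \<open>The gap sum over indices well below, near and well above \<open>n\<close>\<close>

lemma sum_gap_below:
  assumes "p \<ge> 1" "n \<ge> 1"
  shows "(\<Sum>m | 1 \<le> m \<and> 2 * m \<le> n. real m powr (-\<omega>) * gap_dist \<gamma> n m powr (-p))
    \<le> 2 powr p * real n powr (- (p * \<gamma>)) * power_sum \<omega> n"
proof -
  have "(\<Sum>m | 1 \<le> m \<and> 2 * m \<le> n. real m powr (-\<omega>) * gap_dist \<gamma> n m powr (-p))
      \<le> (\<Sum>m | 1 \<le> m \<and> 2 * m \<le> n. 2 powr p * real n powr (- (p * \<gamma>)) * real m powr (-\<omega>))"
  proof (rule sum_mono)
    fix m assume m: "m \<in> {m. 1 \<le> m \<and> 2 * m \<le> n}"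
    \<comment> \<open>Here \<open>m\<close> is at least \<open>n / 2\<close> away from
      \<open>n\<close>, so the gap factor is uniform and only the weights remain to be
      summed.\<close>
    have "real n powr \<gamma> / 2 = (real n / 2) * real n powr (\<gamma> - 1)"
      using assms by (simp add: powr_diff)
    also have "\<dots> \<le> gap_dist \<gamma> n m"
      unfolding gap_dist_def using m by (intro mult_mono) (auto simp: max_def)
    finally have "gap_dist \<gamma> n m powr (-p) \<le> (real n powr \<gamma> / 2) powr (-p)"
      using assms by (intro powr_mono2') auto
    also have "\<dots> = 2 powr p * real n powr (- (p * \<gamma>))"
      by (simp add: powr_divide powr_powr powr_minus_divide mult.commute)
    finally show "real m powr (-\<omega>) * gap_dist \<gamma> n m powr (-p)
        \<le> 2 powr p * real n powr (- (p * \<gamma>)) * real m powr (-\<omega>)"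
      by (simp add: mult.commute mult_left_mono)
  qed
  also have "\<dots> \<le> 2 powr p * real n powr (- (p * \<gamma>)) * power_sum \<omega> n"
    unfolding power_sum_def sum_distrib_left by (rule sum_mono2) auto
  finally show ?thesis .
qed

text \<open>Each distance \<open>1 \<le> j < n\<close> occurs once on either side of
  \<open>n\<close>; the two sides and the centre are each at most
  \<open>power_sum p n\<close>.\<close>

lemma sum_dist_powr:
  assumes "n \<ge> 1"
  shows "(\<Sum>m\<in>{0<..<2*n}. max 1 \<bar>real m - real n\<bar> powr (-p)) \<le> 3 * power_sum p n"
proof -
  let ?f = "\<lambda>m. max 1 \<bar>real m - real n\<bar> powr (-p)"
  have split: "{0<..<2*n} = insert n ({1..<n} \<union> {n<..<2*n})"
    using assms by auto
  have "sum ?f {1..<n} = (\<Sum>j\<in>{1..<n}. real j powr (-p))"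
    by (rule sum.reindex_bij_witness[of _ "\<lambda>j. n - j" "\<lambda>j. n - j"]) (auto simp: max_def)
  moreover have "sum ?f {n<..<2*n} = (\<Sum>j\<in>{1..<n}. real j powr (-p))"
    by (rule sum.reindex_bij_witness[of _ "\<lambda>j. n + j" "\<lambda>j. j - n"]) (auto simp: max_def)
  moreover have "(\<Sum>j\<in>{1..<n}. real j powr (-p)) \<le> power_sum p n"
    unfolding power_sum_def by (rule sum_mono2) auto
  moreover have "sum ?f {0<..<2*n} = 1 + (sum ?f {1..<n} + sum ?f {n<..<2*n})"
  proof -
    have "sum ?f {0<..<2*n} = ?f n + sum ?f ({1..<n} \<union> {n<..<2*n})"
      unfolding split by (rule sum.insert) auto
    also have "sum ?f ({1..<n} \<union> {n<..<2*n}) = sum ?f {1..<n} + sum ?f {n<..<2*n}"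
      by (rule sum.union_disjoint) auto
    finally show ?thesis
      by simp
  qed
  ultimately show ?thesis
    using power_sum_ge_1[OF assms, of p] by linarith
qed

lemma powr_le_of_comparable:
  assumes "x > 0" "y > 0" "x \<le> 2 * y" "y \<le> 2 * x"
  shows "x powr s \<le> 2 powr \<bar>s\<bar> * y powr (s::real)"
proof -
  have "x powr s / y powr s = (x / y) powr s"
    using assms by (simp add: powr_divide)
  also have "\<dots> \<le> 2 powr \<bar>s\<bar>"
  proof (cases "s \<ge> 0")
    case True
    then show ?thesis
      using assms by (auto intro!: powr_mono2 simp: field_simps)
  next
    case False
    then have "(x / y) powr s \<le> (1/2) powr s"
      using assms by (intro powr_mono2') (auto simp: field_simps)
    also have "\<dots> = 2 powr \<bar>s\<bar>"
      using False by (simp add: powr_divide powr_minus_divide)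
    finally show ?thesis .
  qed
  finally show ?thesis
    using assms by (simp add: field_simps)
qed

text \<open>In this range \<open>m\<close> and \<open>max m n\<close> are within a factor 2 of
  \<open>n\<close>, so their powers are replaced by powers of \<open>n\<close>, and only the sum
  over the distances is left.\<close>

lemma sum_gap_near:
  assumes "p \<ge> 1" "n \<ge> 1"
  shows "(\<Sum>m | n < 2 * m \<and> m < 2 * n. real m powr (-\<omega>) * gap_dist \<gamma> n m powr (-p))
    \<le> 3 * 2 powr (\<bar>\<omega>\<bar> + p * \<bar>\<gamma> - 1\<bar>) * real n powr (- \<omega> - p * (\<gamma> - 1)) * power_sum p n"
proof -
  let ?C = "2 powr (\<bar>\<omega>\<bar> + p * \<bar>\<gamma> - 1\<bar>) * real n powr (- \<omega> - p * (\<gamma> - 1))"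
  let ?g = "\<lambda>m. max 1 \<bar>real m - real n\<bar> powr (-p)"
  have "(\<Sum>m | n < 2 * m \<and> m < 2 * n. real m powr (-\<omega>) * gap_dist \<gamma> n m powr (-p))
      \<le> (\<Sum>m | n < 2 * m \<and> m < 2 * n. ?C * ?g m)"
  proof (rule sum_mono)
    fix m assume m: "m \<in> {m. n < 2 * m \<and> m < 2 * n}"
    have 1: "real m powr (-\<omega>) \<le> 2 powr \<bar>\<omega>\<bar> * real n powr (-\<omega>)"
      using powr_le_of_comparable[of "real m" "real n" "-\<omega>"] m by auto
    have "real (max m n) powr (- p * (\<gamma> - 1)) \<le>
        2 powr \<bar>- p * (\<gamma> - 1)\<bar> * real n powr (- p * (\<gamma> - 1))"
      using m by (intro powr_le_of_comparable) (auto simp: max_def)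
    then have 2: "real (max m n) powr (- p * (\<gamma> - 1)) \<le>
        2 powr (p * \<bar>\<gamma> - 1\<bar>) * real n powr (- p * (\<gamma> - 1))"
      using assms by (simp only: abs_mult) simp
    have "gap_dist \<gamma> n m powr (-p) = ?g m * real (max m n) powr (- p * (\<gamma> - 1))"
      by (simp add: gap_dist_def powr_mult powr_powr mult.commute)
    then have "real m powr (-\<omega>) * gap_dist \<gamma> n m powr (-p) =
        (real m powr (-\<omega>) * real (max m n) powr (- p * (\<gamma> - 1))) * ?g m"
      by simp
    also have "\<dots> \<le> ((2 powr \<bar>\<omega>\<bar> * real n powr (-\<omega>)) *
        (2 powr (p * \<bar>\<gamma> - 1\<bar>) * real n powr (- p * (\<gamma> - 1)))) * ?g m"
      by (intro mult_right_mono mult_mono 1 2) auto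
    also have "\<dots> = ?C * ?g m"
    proof -
      have "real n powr (- \<omega> - p * (\<gamma> - 1)) = real n powr (-\<omega>) * real n powr (- p * (\<gamma> - 1))"
        by (simp flip: powr_add)
      then show ?thesis
        by (simp only: powr_add mult_ac)
    qed
    finally show "real m powr (-\<omega>) * gap_dist \<gamma> n m powr (-p) \<le> ?C * ?g m" .
  qed
  also have "\<dots> = ?C * (\<Sum>m | n < 2 * m \<and> m < 2 * n. ?g m)"
    by (simp add: sum_distrib_left)
  also have "\<dots> \<le> ?C * (\<Sum>m\<in>{0<..<2*n}. ?g m)"
    by (intro mult_left_mono sum_mono2) auto
  also have "\<dots> \<le> ?C * (3 * power_sum p n)"
    by (intro mult_left_mono sum_dist_powr assms) auto
  finally show ?thesis
    by (simp add: mult_ac)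
qed

text \<open>The distance to \<open>n\<close> is at least \<open>m / 2\<close>, which leaves the tail
  of a series convergent by \<open>\<omega> + p * \<gamma> > 1\<close>.\<close>

lemma sum_gap_above:
  assumes "p \<ge> 1" "n \<ge> 1" "\<omega> + p * \<gamma> > 1"
  shows "(\<Sum>m\<in>{2*n..N}. real m powr (-\<omega>) * gap_dist \<gamma> n m powr (-p))
    \<le> 2 powr p / (\<omega> + p * \<gamma> - 1) * real n powr (1 - \<omega> - p * \<gamma>)"
proof -
  have "(\<Sum>m\<in>{2*n..N}. real m powr (-\<omega>) * gap_dist \<gamma> n m powr (-p))
      \<le> (\<Sum>m\<in>{2*n..N}. 2 powr p * real m powr (- (\<omega> + p * \<gamma>)))"
  proof (rule sum_mono)
    fix m assume m: "m \<in> {2*n..N}"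
    have "real m powr \<gamma> / 2 = (real m / 2) * real m powr (\<gamma> - 1)"
      using assms m by (simp add: powr_diff)
    also have "\<dots> \<le> gap_dist \<gamma> n m"
      unfolding gap_dist_def using m assms by (intro mult_mono) (auto simp: max_def)
    finally have "gap_dist \<gamma> n m powr (-p) \<le> (real m powr \<gamma> / 2) powr (-p)"
      using assms m by (intro powr_mono2') auto
    also have "\<dots> = 2 powr p * real m powr (- (p * \<gamma>))"
      by (simp add: powr_divide powr_powr powr_minus_divide mult.commute)
    finally have "real m powr (-\<omega>) * gap_dist \<gamma> n m powr (-p)
        \<le> real m powr (-\<omega>) * (2 powr p * real m powr (- (p * \<gamma>)))"
      by (intro mult_left_mono) auto
    also have "\<dots> = 2 powr p * real m powr (- (\<omega> + p * \<gamma>))"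
      by (simp add: mult.left_commute flip: powr_add)
    finally show "real m powr (-\<omega>) * gap_dist \<gamma> n m powr (-p)
        \<le> 2 powr p * real m powr (- (\<omega> + p * \<gamma>))" .
  qed
  also have "\<dots> \<le> 2 powr p * (\<Sum>m\<in>{n<..N}. real m powr (- (\<omega> + p * \<gamma>)))"
    unfolding sum_distrib_left using assms by (intro sum_mono2) auto
  also have "\<dots> \<le> 2 powr p * (real n powr (1 - (\<omega> + p * \<gamma>)) / (\<omega> + p * \<gamma> - 1))"
    by (intro mult_left_mono sum_powr_tail assms) auto
  finally show ?thesis
    by (simp add: algebra_simps)
qed

text \<open>The three quantities bound the three ranges. For \<open>\<omega> \<le> p\<close> the
  range near \<open>n\<close> gives the rate, for \<open>\<omega> > p\<close> the range below it
  does.\<close>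

lemma gap_rate_dominates:
  assumes "p \<ge> 1" "\<gamma> > 0"
  obtains C where "C > 0"
    "\<And>n. n \<ge> 1 \<Longrightarrow> real n powr (- (p * \<gamma>)) * power_sum \<omega> n \<le> C * gap_rate \<omega> \<gamma> p n"
    "\<And>n. n \<ge> 1 \<Longrightarrow> real n powr (- \<omega> - p * (\<gamma> - 1)) * power_sum p n \<le> C * gap_rate \<omega> \<gamma> p n"
    "\<And>n. n \<ge> 1 \<Longrightarrow> real n powr (1 - \<omega> - p * \<gamma>) \<le> C * gap_rate \<omega> \<gamma> p n"
proof (cases "\<omega> \<le> p")
  case True
  show thesis
  proof (rule that[of 1])
    fix n :: nat assume n: "n \<ge> 1"
    have "real n powr (- (p * \<gamma>)) * power_sum \<omega> n \<le>
        real n powr (- (p * \<gamma>)) * (real n powr (p - \<omega>) * power_sum p n)"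
      by (intro mult_left_mono power_sum_exchange True) auto
    also have "\<dots> = 1 * gap_rate \<omega> \<gamma> p n"
    proof -
      have "real n powr (p - \<omega> - p * \<gamma>) = real n powr (- (p * \<gamma>)) * real n powr (p - \<omega>)"
        by (simp flip: powr_add)
      then show ?thesis
        using True by (simp add: gap_rate_def)
    qed
    finally show "real n powr (- (p * \<gamma>)) * power_sum \<omega> n \<le> 1 * gap_rate \<omega> \<gamma> p n" .
    show "real n powr (- \<omega> - p * (\<gamma> - 1)) * power_sum p n \<le> 1 * gap_rate \<omega> \<gamma> p n"
      using True by (simp add: gap_rate_def algebra_simps)
    have "real n powr (1 - \<omega> - p * \<gamma>) * 1 \<le> real n powr (p - \<omega> - p * \<gamma>) * power_sum p n"
      using n assms by (intro mult_mono powr_mono power_sum_ge_1) auto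
    then show "real n powr (1 - \<omega> - p * \<gamma>) \<le> 1 * gap_rate \<omega> \<gamma> p n"
      using True by (simp add: gap_rate_def)
  qed simp
next
  case False
  then have \<omega>: "\<omega> > 1"
    using assms by simp
  show thesis
  \<comment> \<open>The bound of \<open>power_sum \<omega> n\<close>, available because
    \<open>\<omega> > p \<ge> 1\<close>.\<close>
  proof (rule that[of "1 + 1 / (\<omega> - 1)"])
    fix n :: nat assume n: "n \<ge> 1"
    have "real n powr (- (p * \<gamma>)) * power_sum \<omega> n \<le>
        real n powr (- (p * \<gamma>)) * (1 + 1 / (\<omega> - 1))"
      by (intro mult_left_mono power_sum_bounded n \<omega>) auto
    then show 1: "real n powr (- (p * \<gamma>)) * power_sum \<omega> n \<le> (1 + 1 / (\<omega> - 1)) * gap_rate \<omega> \<gamma> p n"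
      using False by (simp add: gap_rate_def mult.commute)
    have "real n powr (- \<omega> - p * (\<gamma> - 1)) * power_sum p n =
        real n powr (- (p * \<gamma>)) * (real n powr (p - \<omega>) * power_sum p n)"
      by (simp add: algebra_simps flip: powr_add)
    also have "\<dots> \<le> real n powr (- (p * \<gamma>)) * power_sum \<omega> n"
      using False by (intro mult_left_mono power_sum_exchange') auto
    finally show "real n powr (- \<omega> - p * (\<gamma> - 1)) * power_sum p n \<le>
        (1 + 1 / (\<omega> - 1)) * gap_rate \<omega> \<gamma> p n"
      using 1 by linarith
    have "real n powr (1 - \<omega> - p * \<gamma>) \<le> real n powr (- (p * \<gamma>))"
      using n \<omega> by (intro powr_mono) auto
    also have "\<dots> \<le> (1 + 1 / (\<omega> - 1)) * gap_rate \<omega> \<gamma> p n"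
      using False \<omega> by (simp add: gap_rate_def algebra_simps)
    finally show "real n powr (1 - \<omega> - p * \<gamma>) \<le> (1 + 1 / (\<omega> - 1)) * gap_rate \<omega> \<gamma> p n" .
  qed (use \<omega> in \<open>auto intro!: add_pos_pos\<close>)
qed

lemma gap_series_bound:
  assumes "p \<ge> 1" "\<gamma> > 0" "\<omega> + p * \<gamma> > 1"
  obtains C where "C > 0" "\<And>n. n \<ge> 1 \<Longrightarrow>
      summable (\<lambda>k. real (Suc k) powr (-\<omega>) * gap_dist \<gamma> n (Suc k) powr (-p)) \<and>
      (\<Sum>k. real (Suc k) powr (-\<omega>) * gap_dist \<gamma> n (Suc k) powr (-p)) \<le> C * gap_rate \<omega> \<gamma> p n"
proof -
  obtain C where C: "C > 0"
    "\<And>n. n \<ge> 1 \<Longrightarrow> real n powr (- (p * \<gamma>)) * power_sum \<omega> n \<le> C * gap_rate \<omega> \<gamma> p n"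
    "\<And>n. n \<ge> 1 \<Longrightarrow> real n powr (- \<omega> - p * (\<gamma> - 1)) * power_sum p n \<le> C * gap_rate \<omega> \<gamma> p n"
    "\<And>n. n \<ge> 1 \<Longrightarrow> real n powr (1 - \<omega> - p * \<gamma>) \<le> C * gap_rate \<omega> \<gamma> p n"
    using gap_rate_dominates[OF assms(1,2), of \<omega>] by blast
  define C1 C2 C3 where "C1 = 2 powr p" and "C2 = 3 * 2 powr (\<bar>\<omega>\<bar> + p * \<bar>\<gamma> - 1\<bar>)"
    and "C3 = 2 powr p / (\<omega> + p * \<gamma> - 1)"
  have pos: "C1 > 0" "C2 > 0" "C3 > 0"
    using assms by (auto simp: C1_def C2_def C3_def)
  show thesis
  proof (rule that[of "(C1 + C2 + C3) * C"])
    show "(C1 + C2 + C3) * C > 0"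
      using pos C by simp
    fix n :: nat assume n: "n \<ge> 1"
    let ?f = "\<lambda>m. real m powr (-\<omega>) * gap_dist \<gamma> n m powr (-p)"
    let ?R = "gap_rate \<omega> \<gamma> p n"
    have bound: "(\<Sum>k<N. ?f (Suc k)) \<le> (C1 + C2 + C3) * C * ?R" for N
    proof -
      let ?A = "{m. 1 \<le> m \<and> 2 * m \<le> n}" and ?B = "{m. n < 2 * m \<and> m < 2 * n}"
      have fin: "finite ?A" "finite ?B"
        by (auto intro: finite_subset[of _ "{..2 * n}"])
      have "(\<Sum>k<N. ?f (Suc k)) = sum ?f {1..N}"
        by (rule sum.reindex_bij_witness[of _ "\<lambda>m. m - 1" Suc]) auto
      \<comment> \<open>For small \<open>N\<close> the three ranges may contain more than
        \<open>{1..N}\<close>; the added terms are nonnegative.\<close>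
      also have "\<dots> \<le> sum ?f (?A \<union> (?B \<union> {2*n..N}))"
        using fin by (intro sum_mono2) auto
      also have "\<dots> = sum ?f ?A + (sum ?f ?B + sum ?f {2*n..N})"
        using fin n by (subst sum.union_disjoint, simp, simp, force, subst sum.union_disjoint) auto
      also have "sum ?f ?A \<le> C1 * (C * ?R)"
        using sum_gap_below[OF assms(1) n, of \<omega> \<gamma>] mult_left_mono[OF C(2)[OF n], of C1] pos
        unfolding C1_def by (simp only: mult.assoc) linarith
      also have "sum ?f ?B \<le> C2 * (C * ?R)"
        using sum_gap_near[OF assms(1) n, of \<omega> \<gamma>] mult_left_mono[OF C(3)[OF n], of C2] pos
        unfolding C2_def by (simp only: mult.assoc) linarith
      also have "sum ?f {2*n..N} \<le> C3 * (C * ?R)"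
        using sum_gap_above[OF assms(1) n assms(3), of N] mult_left_mono[OF C(4)[OF n], of C3] pos
        unfolding C3_def by linarith
      finally show ?thesis
        by (simp add: algebra_simps)
    qed
    have "summable (\<lambda>k. ?f (Suc k))"
      by (rule summableI_nonneg_bounded[OF _ bound]) simp
    then show "summable (\<lambda>k. ?f (Suc k)) \<and> (\<Sum>k. ?f (Suc k)) \<le> (C1 + C2 + C3) * C * ?R"
      using suminf_le_const[OF _ bound] by blast
  qed
qed

text \<open>The case \<open>p = 1\<close>; the harmonic sum in \<open>gap_rate\<close> produces the
  logarithm.\<close>

lemma sigma_series_bound:
  assumes "\<gamma> > 0" "\<omega> + \<gamma> > 1"
  shows "\<exists>C>0. \<forall>n\<ge>1.
      summable (\<lambda>k. real (Suc k) powr (-\<omega>) / gap_dist \<gamma> n (Suc k)) \<and>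
      (\<Sum>k. real (Suc k) powr (-\<omega>) / gap_dist \<gamma> n (Suc k)) \<le> C * sigma_rate \<omega> \<gamma> n"
proof (rule gap_series_bound[of 1 \<gamma> \<omega>])
  fix C
  assume C: "C > 0" "\<And>n. n \<ge> 1 \<Longrightarrow>
      summable (\<lambda>k. real (Suc k) powr (-\<omega>) * gap_dist \<gamma> n (Suc k) powr (-1)) \<and>
      (\<Sum>k. real (Suc k) powr (-\<omega>) * gap_dist \<gamma> n (Suc k) powr (-1)) \<le> C * gap_rate \<omega> \<gamma> 1 n"
  show ?thesis
  proof (intro exI[of _ "C"] conjI[of "0 < _"] allI impI)
    fix n :: nat assume n: "n \<ge> 1"
    have "gap_rate \<omega> \<gamma> 1 n \<le> sigma_rate \<omega> \<gamma> n"
    proof -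
      have exponent: "- \<omega> - \<gamma> + 1 = 1 - \<omega> - \<gamma>"
        by simp
      show ?thesis
        unfolding sigma_rate_def gap_rate_def exponent
        using mult_left_mono[OF power_sum_1[OF n], of "real n powr (1 - \<omega> - \<gamma>)"] by simp
    qed
    then have le: "C * gap_rate \<omega> \<gamma> 1 n \<le> C * sigma_rate \<omega> \<gamma> n"
      using C(1) by (intro mult_left_mono) auto
    have "real (Suc k) powr (-\<omega>) * gap_dist \<gamma> n (Suc k) powr (-1) =
        real (Suc k) powr (-\<omega>) / gap_dist \<gamma> n (Suc k)" for k
      using gap_dist_pos[OF n, of \<gamma> "Suc k"] by (simp only: powr_minus_divide powr_one) simp
    from C(2)[OF n, unfolded this] le show "summable (\<lambda>k. real (Suc k) powr (-\<omega>) / gap_dist \<gamma> n (Suc k)) \<and>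
        (\<Sum>k. real (Suc k) powr (-\<omega>) / gap_dist \<gamma> n (Suc k)) \<le> C * sigma_rate \<omega> \<gamma> n"
      by linarith
  qed (use C in simp)
qed (use assms in auto)

lemma tau_series_bound:
  assumes "\<gamma> > 0" "\<omega> + 2 * \<gamma> > 1"
  shows "\<exists>C>0. \<forall>n\<ge>1.
      summable (\<lambda>k. real (Suc k) powr (-\<omega>) / (gap_dist \<gamma> n (Suc k))\<^sup>2) \<and>
      (\<Sum>k. real (Suc k) powr (-\<omega>) / (gap_dist \<gamma> n (Suc k))\<^sup>2) \<le> C * tau_rate \<omega> \<gamma> n"
proof (rule gap_series_bound[of 2 \<gamma> \<omega>])
  fix C
  assume C: "C > 0" "\<And>n. n \<ge> 1 \<Longrightarrow>
      summable (\<lambda>k. real (Suc k) powr (-\<omega>) * gap_dist \<gamma> n (Suc k) powr (-2)) \<and>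
      (\<Sum>k. real (Suc k) powr (-\<omega>) * gap_dist \<gamma> n (Suc k) powr (-2)) \<le> C * gap_rate \<omega> \<gamma> 2 n"
  show ?thesis
  \<comment> \<open>The factor 2 bounds \<open>power_sum 2 n\<close>, which is why no logarithm
    appears for \<open>p = 2\<close>.\<close>
  proof (intro exI[of _ "C * 2"] conjI[of "0 < _"] allI impI)
    fix n :: nat assume n: "n \<ge> 1"
    have "power_sum 2 n \<le> 2"
      using power_sum_bounded[of 2 n] n by simp
    then have "real n powr (2 - \<omega> - 2 * \<gamma>) * power_sum 2 n \<le> real n powr (2 - \<omega> - 2 * \<gamma>) * 2"
      by (intro mult_left_mono) auto
    moreover have exponent: "- (\<omega> + 2 * \<gamma> - 2) = 2 - \<omega> - 2 * \<gamma>"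
      by simp
    ultimately have "gap_rate \<omega> \<gamma> 2 n \<le> 2 * tau_rate \<omega> \<gamma> n"
      unfolding gap_rate_def tau_rate_def exponent by simp
    then have le: "C * gap_rate \<omega> \<gamma> 2 n \<le> C * (2 * tau_rate \<omega> \<gamma> n)"
      using C(1) by (intro mult_left_mono) auto
    have "real (Suc k) powr (-\<omega>) * gap_dist \<gamma> n (Suc k) powr (-2) =
        real (Suc k) powr (-\<omega>) / (gap_dist \<gamma> n (Suc k))\<^sup>2" for k
      using gap_dist_pos[OF n, of \<gamma> "Suc k"]
      by (simp only: powr_minus_divide powr_numeral) simp
    from C(2)[OF n, unfolded this] le show "summable (\<lambda>k. real (Suc k) powr (-\<omega>) / (gap_dist \<gamma> n (Suc k))\<^sup>2) \<and>
        (\<Sum>k. real (Suc k) powr (-\<omega>) / (gap_dist \<gamma> n (Suc k))\<^sup>2) \<le> C * 2 * tau_rate \<omega> \<gamma> n"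
      by linarith
  qed (use C in simp)
qed (use assms in auto)

section \<open>Integrals over rectangles\<close>

text \<open>The finitely many exceptional parameters accommodate the corners of a rectangle.\<close>

definition derivative_bounded :: "(real \<Rightarrow> complex) \<Rightarrow> real \<Rightarrow> bool" where
  "derivative_bounded g L \<longleftrightarrow>
     (\<exists>S. finite S \<and> (\<forall>t\<in>{0..1} - S. \<exists>d. (g has_vector_derivative d) (at t) \<and> cmod d \<le> L))"

lemma derivative_bounded_linepath:
  assumes "cmod (q - p) \<le> L"
  shows "derivative_bounded (linepath p q) L"
  unfolding derivative_bounded_def
  using has_vector_derivative_linepath_within[of p q _ UNIV] assms by (intro exI[of _ "{}"]) auto

lemma derivative_bounded_mono: "derivative_bounded g L \<Longrightarrow> L \<le> L' \<Longrightarrow> derivative_bounded g L'"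
  unfolding derivative_bounded_def by (meson order_trans)

text \<open>Each half is traversed at double speed. The exceptional set consists of the junction and
  the rescaled old exceptions.\<close>

lemma derivative_bounded_join:
  assumes "derivative_bounded g1 L" "derivative_bounded g2 L"
  shows "derivative_bounded (g1 +++ g2) (2 * L)"
proof -
  obtain S1 S2 where S: "finite S1" "finite S2"
    and d1: "\<And>t. t \<in> {0..1} - S1 \<Longrightarrow> \<exists>d. (g1 has_vector_derivative d) (at t) \<and> cmod d \<le> L"
    and d2: "\<And>t. t \<in> {0..1} - S2 \<Longrightarrow> \<exists>d. (g2 has_vector_derivative d) (at t) \<and> cmod d \<le> L"
    using assms unfolding derivative_bounded_def by metis
  define S where "S = insert (1/2) ((\<lambda>t. t / 2) ` S1 \<union> (\<lambda>t. (t + 1) / 2) ` S2)"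
  have "\<exists>d. ((g1 +++ g2) has_vector_derivative d) (at t) \<and> cmod d \<le> 2 * L"
    if t: "t \<in> {0..1} - S" for t
  proof (cases "t < 1/2")
    case True
    have "2 * t \<notin> S1"
      using t imageI[of "2 * t" S1 "\<lambda>t. t / 2"] by (auto simp: S_def)
    then obtain d where d: "(g1 has_vector_derivative d) (at (2 * t))" "cmod d \<le> L"
      using d1[of "2 * t"] True t by auto
    have "((\<lambda>t. 2 * t) has_vector_derivative 2) (at t)"
      by (auto intro!: derivative_eq_intros)
    from vector_diff_chain_at[OF this d(1)]
    have "((g1 \<circ> (\<lambda>t. 2 * t)) has_vector_derivative 2 *\<^sub>R d) (at t)" .
    then have "((g1 +++ g2) has_vector_derivative 2 *\<^sub>R d) (at t)"
      by (rule has_vector_derivative_transform_within_open[of _ _ _ "{..<1/2}"])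
        (use True in \<open>auto simp: joinpaths_def\<close>)
    then show ?thesis
      using d(2) by (intro exI[of _ "2 *\<^sub>R d"]) simp
  next
    case False
    have "t \<noteq> 1/2"
      using t by (auto simp: S_def)
    then have gt: "t > 1/2"
      using False by simp
    have "2 * t - 1 \<notin> S2"
      using t imageI[of "2 * t - 1" S2 "\<lambda>t. (t + 1) / 2"] by (auto simp: S_def)
    then obtain d where d: "(g2 has_vector_derivative d) (at (2 * t - 1))" "cmod d \<le> L"
      using d2[of "2 * t - 1"] gt t by auto
    have "((\<lambda>t. 2 * t - 1) has_vector_derivative 2) (at t)"
      by (auto intro!: derivative_eq_intros)
    from vector_diff_chain_at[OF this d(1)]
    have "((g2 \<circ> (\<lambda>t. 2 * t - 1)) has_vector_derivative 2 *\<^sub>R d) (at t)" .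
    then have "((g1 +++ g2) has_vector_derivative 2 *\<^sub>R d) (at t)"
      by (rule has_vector_derivative_transform_within_open[of _ _ _ "{1/2<..}"])
        (use gt in \<open>auto simp: joinpaths_def\<close>)
    then show ?thesis
      using d(2) by (intro exI[of _ "2 *\<^sub>R d"]) simp
  qed
  moreover have "finite S"
    using S by (simp add: S_def)
  ultimately show ?thesis
    unfolding derivative_bounded_def by blast
qed

text \<open>The four sides are combined by three nested joins, each doubling the bound, hence the
  factor 8.\<close>

lemma derivative_bounded_rectpath:
  assumes "\<bar>Re q - Re p\<bar> \<le> L" "\<bar>Im q - Im p\<bar> \<le> L"
  shows "derivative_bounded (rectpath p q) (8 * L)"
proof -
  have L: "0 \<le> L"
    using assms by linarith
  have line: "derivative_bounded (linepath u v) L"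
    if "Re u = Re v \<and> \<bar>Im v - Im u\<bar> \<le> L \<or> Im u = Im v \<and> \<bar>Re v - Re u\<bar> \<le> L" for u v
    using that by (intro derivative_bounded_linepath) (auto simp: cmod_def)
  define p' q' where "p' = Complex (Re q) (Im p)" and "q' = Complex (Re p) (Im q)"
  have sides: "derivative_bounded (linepath p p') L" "derivative_bounded (linepath p' q) L"
    "derivative_bounded (linepath q q') L" "derivative_bounded (linepath q' p) L"
    using assms by (auto intro!: line simp: p'_def q'_def abs_minus_commute)
  have "derivative_bounded (linepath p p' +++ linepath p' q +++ linepath q q' +++ linepath q' p)
      (2 * (2 * (2 * L)))"
    using L by (intro derivative_bounded_join sides derivative_bounded_mono[OF sides(1)]
        derivative_bounded_mono[OF sides(2)]) auto
  then show ?thesis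
    by (simp add: rectpath_def Let_def p'_def q'_def)
qed

text \<open>No integrability is needed: the Henstock--Kurzweil integral of a non-integrable function
  is 0.\<close>

lemma norm_vector_contour_integral_le:
  fixes f :: "complex \<Rightarrow> 'h::complex_hilbert"
  assumes g: "derivative_bounded g L" and F: "\<And>z. z \<in> path_image g \<Longrightarrow> norm (f z) \<le> F"
    and nonneg: "0 \<le> L" "0 \<le> F"
  shows "norm (vector_contour_integral g f) \<le> L * F"
proof (cases "(\<lambda>t. vector_derivative g (at t within {0..1}) *\<^sub>C f (g t)) integrable_on {0..1}")
  case True
  obtain S where S: "finite S"
    "\<And>t. t \<in> {0..1} - S \<Longrightarrow> \<exists>d. (g has_vector_derivative d) (at t) \<and> cmod d \<le> L"
    using g unfolding derivative_bounded_def by blast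
  have "norm (vector_derivative g (at t within {0..1}) *\<^sub>C f (g t)) \<le> L * F"
    if t: "t \<in> cbox 0 1 - S" for t
  proof -
    obtain d where d: "(g has_vector_derivative d) (at t)" "cmod d \<le> L"
      using S(2)[of t] t by auto
    have "vector_derivative g (at t within {0..1}) = d"
      using vector_derivative_at_within_ivl[OF d(1), of 0 1] t by auto
    moreover have "norm (f (g t)) \<le> F"
      using t by (intro F) (auto simp: path_image_def)
    ultimately show ?thesis
      using d(2) nonneg by (simp add: norm_scaleC mult_mono)
  qed
  moreover have "((\<lambda>t. vector_derivative g (at t within {0..1}) *\<^sub>C f (g t)) has_integral
      vector_contour_integral g f) (cbox 0 1)"
    using True by (simp add: vector_contour_integral_def has_integral_integral)
  ultimately have "norm (vector_contour_integral g f) \<le> L * F * measure lborel (cbox 0 (1::real))"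
    using nonneg S(1) by (intro has_integral_bound_spike_finite[of "L * F" S]) auto
  then show ?thesis
    by simp
next
  case False
  then show ?thesis
    using nonneg by (simp add: vector_contour_integral_def not_integrable_integral)
qed

section \<open>Distance of the contours to the spectrum\<close>

lemma sum_powr_lower:
  assumes "1 \<le> n" "n < m"
  shows "1 / (3 * 2 powr \<bar>s\<bar>) * (real m - real n) * real m powr s \<le> (\<Sum>j\<in>{n..<m}. real j powr s)"
proof -
  \<comment> \<open>Only the indices \<open>j \<ge> m / 2\<close> are kept; they are comparable to \<open>m\<close>.\<close>
  define k where "k = max n ((m + 1) div 2)"
  \<comment> \<open>At least a third of the indices survive; this is the 3 in the constant, while
    \<open>2 powr \<bar>s\<bar>\<close> pays for comparing \<open>j\<close> with
    \<open>m\<close>.\<close>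
  have "n \<le> k" and count: "m - n \<le> 3 * (m - k)"
    using assms by (auto simp: k_def max_def)
  have "1 / (3 * 2 powr \<bar>s\<bar>) * (real m - real n) * real m powr s =
      real (m - n) * (real m powr s / 2 powr \<bar>s\<bar>) / 3"
    using assms by (simp add: of_nat_diff)
  also have "\<dots> \<le> real (3 * (m - k)) * (real m powr s / 2 powr \<bar>s\<bar>) / 3"
    using count by (intro divide_right_mono mult_right_mono of_nat_mono) auto
  also have "\<dots> = (\<Sum>j\<in>{k..<m}. real m powr s / 2 powr \<bar>s\<bar>)"
    by simp
  also have "\<dots> \<le> (\<Sum>j\<in>{k..<m}. real j powr s)"
  proof (rule sum_mono)
    fix j assume j: "j \<in> {k..<m}"
    then have "n \<le> j" "m \<le> 2 * j"
      by (auto simp: k_def)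
    then have "real m powr s \<le> 2 powr \<bar>s\<bar> * real j powr s"
      using assms j by (intro powr_le_of_comparable) auto
    then show "real m powr s / 2 powr \<bar>s\<bar> \<le> real j powr s"
      by (simp add: field_simps)
  qed
  also have "\<dots> \<le> (\<Sum>j\<in>{n..<m}. real j powr s)"
    using \<open>n \<le> k\<close> by (intro sum_mono2) auto
  finally show ?thesis .
qed

locale spectral_gaps =
  fixes \<mu> :: "nat \<Rightarrow> real" and \<kappa> \<gamma> :: real and N0 :: nat
  assumes \<kappa>: "\<kappa> > 0" and \<gamma>: "\<gamma> > 0" and N0: "N0 > 0"
    and \<mu>_mono: "\<forall>k\<ge>1. \<mu> k \<le> \<mu> (k + 1)"
    and gaps: "\<forall>k\<ge>N0. \<mu> (k + 1) - \<mu> k \<ge> \<kappa> * real k powr (\<gamma> - 1)"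
begin

text \<open>Half of the constant that \<open>sum_powr_lower\<close> provides; the other half is
  spent on the indices below \<open>N0\<close>.\<close>

definition gap_const :: real where
  "gap_const = \<kappa> / (6 * 2 powr \<bar>\<gamma> - 1\<bar>)"

lemma gap_const_pos: "gap_const > 0"
  using \<kappa> by (simp add: gap_const_def)

lemma \<mu>_le:
  assumes "1 \<le> m" "m \<le> n"
  shows "\<mu> m \<le> \<mu> n"
  using assms(2)
proof (induction n rule: dec_induct)
  case (step n)
  then have "\<mu> n \<le> \<mu> (Suc n)"
    using \<mu>_mono assms(1) by simp
  then show ?case
    using step by simp
qed simp

lemma gap_sum:
  assumes "N0 \<le> n" "n < m"
  shows "2 * gap_const * (real m - real n) * real m powr (\<gamma> - 1) \<le> \<mu> m - \<mu> n"
proof -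
  have "2 * gap_const * (real m - real n) * real m powr (\<gamma> - 1) =
      \<kappa> * (1 / (3 * 2 powr \<bar>\<gamma> - 1\<bar>) * (real m - real n) * real m powr (\<gamma> - 1))"
    by (simp add: gap_const_def)
  also have "\<dots> \<le> \<kappa> * (\<Sum>j\<in>{n..<m}. real j powr (\<gamma> - 1))"
    using assms N0 \<kappa> by (intro mult_left_mono sum_powr_lower) auto
  also have "\<dots> \<le> (\<Sum>j\<in>{n..<m}. \<mu> (Suc j) - \<mu> j)"
    unfolding sum_distrib_left using assms gaps by (intro sum_mono) auto
  also have "\<dots> = \<mu> m - \<mu> n"
    using assms by (intro sum_Suc_diff') auto
  finally show ?thesis .
qed

lemma gap_dist_le:
  assumes "2 * N0 \<le> n" "1 \<le> m" "m \<noteq> n"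
  shows "gap_const * gap_dist \<gamma> n m \<le> \<bar>\<mu> m - \<mu> n\<bar>"
proof -
  have half: "gap_const * x \<le> 2 * gap_const * x" if "x \<ge> 0" for x
    using that gap_const_pos by simp
  consider "n < m" | "N0 \<le> m" "m < n" | "m < N0"
    using assms by linarith
  then show ?thesis
  proof cases
    case 1
    then have "gap_dist \<gamma> n m = (real m - real n) * real m powr (\<gamma> - 1)"
      by (simp add: gap_dist_def max_def)
    then show ?thesis
      using gap_sum[of n m] 1 assms half[of "gap_dist \<gamma> n m"] by (simp add: mult.assoc)
  next
    case 2
    then have "gap_dist \<gamma> n m = (real n - real m) * real n powr (\<gamma> - 1)"
      by (simp add: gap_dist_def max_def)
    then show ?thesis
      using gap_sum[of m n] 2 half[of "gap_dist \<gamma> n m"] by (simp add: mult.assoc)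
  next
    \<comment> \<open>Below \<open>N0\<close> only monotonicity is available, so \<open>m\<close> is
      replaced by \<open>N0\<close>. Since \<open>n \<ge> 2 * N0\<close>, this at most halves the
      distance of the indices.\<close>
    case 3
    then have "gap_dist \<gamma> n m = (real n - real m) * real n powr (\<gamma> - 1)"
      using assms by (simp add: gap_dist_def max_def)
    also have "\<dots> \<le> (2 * (real n - real N0)) * real n powr (\<gamma> - 1)"
      using assms by (intro mult_right_mono) auto
    finally have "gap_const * gap_dist \<gamma> n m \<le>
        gap_const * ((2 * (real n - real N0)) * real n powr (\<gamma> - 1))"
      using gap_const_pos by (intro mult_left_mono) auto
    also have "\<dots> \<le> \<mu> n - \<mu> N0"
    proof -
      have "2 * gap_const * (real n - real N0) * real n powr (\<gamma> - 1) \<le> \<mu> n - \<mu> N0"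
        using assms N0 by (intro gap_sum) auto
      then show ?thesis
        by (simp only: mult_ac)
    qed
    also have "\<dots> \<le> \<mu> n - \<mu> m"
      using \<mu>_le[of m N0] assms 3 by simp
    finally show ?thesis
      by simp
  qed
qed

section \<open>Geometry of the contours\<close>

definition left_half_width :: "nat \<Rightarrow> real" where
  "left_half_width n = \<kappa> / 2 * (real n - 1) powr (\<gamma> - 1)"

text \<open>This is also the half height of the rectangle.\<close>

definition right_half_width :: "nat \<Rightarrow> real" where
  "right_half_width n = \<kappa> / 2 * real n powr (\<gamma> - 1)"

lemma half_width_comparable:
  assumes "n \<ge> 2"
  shows "left_half_width n \<le> 2 powr \<bar>\<gamma> - 1\<bar> * right_half_width n"
    and "right_half_width n \<le> 2 powr \<bar>\<gamma> - 1\<bar> * left_half_width n"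
proof -
  have "(real n - 1) powr (\<gamma> - 1) \<le> 2 powr \<bar>\<gamma> - 1\<bar> * real n powr (\<gamma> - 1)"
    "real n powr (\<gamma> - 1) \<le> 2 powr \<bar>\<gamma> - 1\<bar> * (real n - 1) powr (\<gamma> - 1)"
    using assms by (intro powr_le_of_comparable; simp)+
  then have "\<kappa> / 2 * (real n - 1) powr (\<gamma> - 1) \<le> \<kappa> / 2 * (2 powr \<bar>\<gamma> - 1\<bar> * real n powr (\<gamma> - 1))"
    "\<kappa> / 2 * real n powr (\<gamma> - 1) \<le> \<kappa> / 2 * (2 powr \<bar>\<gamma> - 1\<bar> * (real n - 1) powr (\<gamma> - 1))"
    using \<kappa> by (intro mult_left_mono; simp)+
  then show "left_half_width n \<le> 2 powr \<bar>\<gamma> - 1\<bar> * right_half_width n"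
    "right_half_width n \<le> 2 powr \<bar>\<gamma> - 1\<bar> * left_half_width n"
    unfolding left_half_width_def right_half_width_def by (simp_all only: mult.left_commute)
qed

lemma half_width_pos:
  assumes "n \<ge> 2"
  shows "0 < left_half_width n" "0 < right_half_width n"
  using assms \<kappa> by (auto simp: left_half_width_def right_half_width_def)

context
  fixes n :: nat and z :: complex
  assumes n: "2 * N0 \<le> n" and z: "z \<in> path_image (Gamma_contour \<kappa> \<gamma> \<mu> n)"
begin

lemma n_bounds: "n \<ge> 2" "N0 \<le> n - 1"
  using n N0 by auto

lemma contour_point:
  shows "\<mu> n - left_half_width n \<le> Re z" "Re z \<le> \<mu> n + right_half_width n"
    and "Re z = \<mu> n - left_half_width n \<or> Re z = \<mu> n + right_half_width n \<or> \<bar>Im z\<bar> = right_half_width n"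
proof -
  have "z \<in> path_image (rectpath (Complex (\<mu> n - left_half_width n) (- right_half_width n))
      (Complex (\<mu> n + right_half_width n) (right_half_width n)))"
    using z unfolding Gamma_contour_def left_half_width_def right_half_width_def .
  then show "\<mu> n - left_half_width n \<le> Re z" "Re z \<le> \<mu> n + right_half_width n"
    "Re z = \<mu> n - left_half_width n \<or> Re z = \<mu> n + right_half_width n \<or> \<bar>Im z\<bar> = right_half_width n"
    using half_width_pos[OF n_bounds(1)] by (auto simp: path_image_rectpath)
qed

lemma contour_dist_self:
  "min (left_half_width n) (right_half_width n) \<le> cmod (z - complex_of_real (\<mu> n))"
  using contour_point(3) abs_Re_le_cmod[of "z - complex_of_real (\<mu> n)"]
    abs_Im_le_cmod[of "z - complex_of_real (\<mu> n)"] half_width_pos[OF n_bounds(1)]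
  by auto

text \<open>The rectangle reaches at most halfway across the gaps next to \<open>\<mu> n\<close>, so
  already the real part keeps half the distance to every other eigenvalue.\<close>

lemma contour_dist_other:
  assumes "1 \<le> m" "m \<noteq> n"
  shows "\<bar>\<mu> m - \<mu> n\<bar> / 2 \<le> cmod (z - complex_of_real (\<mu> m))"
    and "min (left_half_width n) (right_half_width n) \<le> cmod (z - complex_of_real (\<mu> m))"
proof -
  have "\<bar>\<mu> m - \<mu> n\<bar> / 2 \<le> \<bar>Re z - \<mu> m\<bar> \<and> min (left_half_width n) (right_half_width n) \<le> \<bar>Re z - \<mu> m\<bar>"
  proof (cases "m > n")
    case True
    have "2 * right_half_width n \<le> \<mu> (n + 1) - \<mu> n"
      using gaps n by (simp add: right_half_width_def)
    also have "\<dots> \<le> \<mu> m - \<mu> n"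
      using \<mu>_le[of "n + 1" m] True by simp
    finally show ?thesis
      using contour_point(2) half_width_pos[OF n_bounds(1)] by auto
  next
    case False
    \<comment> \<open>The gap to the left of \<open>\<mu> n\<close> is the one with index
      \<open>n - 1\<close>, which is at least \<open>N0\<close>.\<close>
    have "2 * left_half_width n \<le> \<mu> (n - 1 + 1) - \<mu> (n - 1)"
      using gaps n_bounds by (auto simp: left_half_width_def)
    also have "\<dots> \<le> \<mu> n - \<mu> m"
      using \<mu>_le[of m "n - 1"] False assms n_bounds by simp
    finally show ?thesis
      using contour_point(1) half_width_pos[OF n_bounds(1)] by auto
  qed
  moreover have "\<bar>Re z - \<mu> m\<bar> \<le> cmod (z - complex_of_real (\<mu> m))"
    using abs_Re_le_cmod[of "z - complex_of_real (\<mu> m)"] by simp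
  ultimately show "\<bar>\<mu> m - \<mu> n\<bar> / 2 \<le> cmod (z - complex_of_real (\<mu> m))"
    "min (left_half_width n) (right_half_width n) \<le> cmod (z - complex_of_real (\<mu> m))"
    by linarith+
qed

lemma contour_dist_min:
  assumes "1 \<le> m"
  shows "min (left_half_width n) (right_half_width n) \<le> cmod (z - complex_of_real (\<mu> m))"
  using contour_dist_self contour_dist_other(2)[OF assms] by (cases "m = n") auto

lemma contour_dist_gap:
  assumes "1 \<le> m"
  shows "gap_const / 2 * gap_dist \<gamma> n m \<le> cmod (z - complex_of_real (\<mu> m))"
proof (cases "m = n")
  case True
  let ?p = "2 powr \<bar>\<gamma> - 1\<bar>"
  have p: "?p \<ge> 1"
    by (rule ge_one_powr_ge_zero) auto
  \<comment> \<open>A multiple of \<open>real n powr (\<gamma> - 1)\<close> below both half widths,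
    hence below the distance of the contour to its own eigenvalue.\<close>
  define t where "t = right_half_width n / ?p"
  have "t \<le> left_half_width n" "t \<le> right_half_width n" "0 \<le> t"
    using half_width_comparable[OF n_bounds(1)] half_width_pos[OF n_bounds(1)] p
    by (simp_all add: t_def field_simps)
  moreover have "gap_const / 2 * gap_dist \<gamma> n m = t / 6"
    using True by (simp add: t_def gap_const_def gap_dist_def right_half_width_def)
  ultimately show ?thesis
    using contour_dist_self True by simp
next
  case False
  have "gap_const / 2 * gap_dist \<gamma> n m = gap_const * gap_dist \<gamma> n m / 2"
    by simp
  also have "\<dots> \<le> \<bar>\<mu> m - \<mu> n\<bar> / 2"
    by (intro divide_right_mono gap_dist_le n assms False) simp
  also have "\<dots> \<le> cmod (z - complex_of_real (\<mu> m))"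
    by (rule contour_dist_other(1)[OF assms False])
  finally show ?thesis .
qed

end

text \<open>Width and height are both at most \<open>2 powr \<bar>\<gamma> - 1\<bar> + 1\<close>
  times the right half width, because the left one is comparable to it.\<close>

lemma derivative_bounded_Gamma:
  assumes "2 * N0 \<le> n"
  shows "derivative_bounded (Gamma_contour \<kappa> \<gamma> \<mu> n) (8 * ((2 powr \<bar>\<gamma> - 1\<bar> + 1) * right_half_width n))"
proof -
  have n: "n \<ge> 2"
    using assms N0 by simp
  have "1 * right_half_width n \<le> 2 powr \<bar>\<gamma> - 1\<bar> * right_half_width n"
    using half_width_pos[OF n] by (intro mult_right_mono ge_one_powr_ge_zero) auto
  then have "derivative_bounded (rectpath
      (Complex (\<mu> n - left_half_width n) (- right_half_width n))
      (Complex (\<mu> n + right_half_width n) (right_half_width n)))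
      (8 * ((2 powr \<bar>\<gamma> - 1\<bar> + 1) * right_half_width n))"
    using half_width_pos[OF n] half_width_comparable(1)[OF n]
    by (intro derivative_bounded_rectpath) (auto simp: algebra_simps)
  then show ?thesis
    by (simp add: Gamma_contour_def left_half_width_def right_half_width_def)
qed

end

section \<open>The norms of the perturbation coefficients\<close>

text \<open>The gap estimates count from 1 and the basis from 0, so \<open>\<psi> n\<close> is the
  basis vector of index \<open>n - 1\<close>; this is where \<open>\<rho> (n - 1)\<close> comes
  from.\<close>

locale perturbed_operator = spectral_gaps \<mu> \<kappa> \<gamma> N0 +
  diagonal_form "\<lambda>k. \<psi> (Suc k)" V a b "\<lambda>k. \<mu> (Suc k)"
  for \<mu> \<kappa> \<gamma> N0 and \<psi> :: "nat \<Rightarrow> 'h::complex_hilbert" and V a b +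
  fixes \<alpha> M :: real
  assumes M: "M > 0" and b_bound: "\<forall>m\<ge>1. \<forall>n\<ge>1.
      norm (b (\<psi> m) (\<psi> n)) \<le> M * real m powr (- \<alpha>) * real n powr (- \<alpha>)"
begin

lemma norm_KBK_contour:
  assumes n: "2 * N0 \<le> n" and z: "z \<in> path_image (Gamma_contour \<kappa> \<gamma> \<mu> n)"
    and \<rho>: "\<rho> = (\<lambda>l. gap_const / 2 * gap_dist \<gamma> n (Suc l))"
    and S: "k = 0 \<or> summable (\<lambda>l. real (Suc l) powr (- (2 * \<alpha>)) / \<rho> l)"
    and T: "summable (\<lambda>l. real (Suc l) powr (- (2 * \<alpha>)) / (\<rho> l)\<^sup>2)"
  shows "norm (K_op \<mu> \<psi> z ((B_op \<mu> \<psi> b z ^^ Suc k) (K_op \<mu> \<psi> z (\<psi> n)))) \<le>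
    M * real n powr (- \<alpha>) / \<rho> (n - 1) *
      (M * (\<Sum>l. real (Suc l) powr (- (2 * \<alpha>)) / \<rho> l)) ^ k *
      sqrt (\<Sum>l. real (Suc l) powr (- (2 * \<alpha>)) / (\<rho> l)\<^sup>2)"
proof -
  have n2: "n \<ge> 2"
    using n N0 by simp
  interpret perturbation_at "\<lambda>k. \<psi> (Suc k)" V a b "\<lambda>k. \<mu> (Suc k)" z
    "min (left_half_width n) (right_half_width n)"
    by unfold_locales (use half_width_pos[OF n2] contour_dist_min[OF n z] in auto)
  have K: "K_op \<mu> \<psi> z = K"
    by (rule ext) (simp only: K_op_def diag_op_def kern_def)
  have B: "B_op \<mu> \<psi> b z = B"
    unfolding B_op_def B_def K ..
  have sq: "(real (Suc l) powr (- \<alpha>))\<^sup>2 = real (Suc l) powr (- (2 * \<alpha>))" for l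
    by (simp add: power2_eq_square flip: powr_add)
  have "norm (K ((B ^^ Suc k) (K (\<psi> (Suc (n - 1)))))) \<le>
    M * real (Suc (n - 1)) powr (- \<alpha>) / \<rho> (n - 1) *
      (M * (\<Sum>l. (real (Suc l) powr (- \<alpha>))\<^sup>2 / \<rho> l)) ^ k *
      sqrt (\<Sum>l. (real (Suc l) powr (- \<alpha>))\<^sup>2 / (\<rho> l)\<^sup>2)"
  proof (rule norm_KBK_le)
    show "0 < \<rho> l" for l
      unfolding \<rho> using gap_dist_pos[of n \<gamma> "Suc l"] gap_const_pos n2 by simp
    show "\<rho> l \<le> cmod (z - complex_of_real (\<mu> (Suc l)))" for l
      unfolding \<rho> by (rule contour_dist_gap[OF n z]) simp
    show "cmod (b (\<psi> (Suc l)) (\<psi> (Suc m))) \<le>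
        M * real (Suc l) powr (- \<alpha>) * real (Suc m) powr (- \<alpha>)" for l m
      using b_bound[rule_format, of "Suc l" "Suc m"] by simp
  qed (use M S T in \<open>simp_all only: sq less_imp_le powr_ge_zero\<close>)
  then show ?thesis
    using n2 unfolding K B sq by simp
qed

lemma norm_phi_bound:
  assumes exponents: "2 * \<alpha> + 2 * \<gamma> > 1" and k: "k = 0 \<or> 2 * \<alpha> + \<gamma> > 1"
  obtains C where "\<And>n. 2 * N0 \<le> n \<Longrightarrow> norm (phi \<kappa> \<gamma> \<mu> \<psi> b (Suc k) n) \<le>
    C * (real n powr (- \<alpha>) * sigma_rate (2 * \<alpha>) \<gamma> n ^ k * sqrt (tau_rate (2 * \<alpha>) \<gamma> n))"
proof -
  obtain CT where CT: "CT > 0" "\<forall>n\<ge>1.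
      summable (\<lambda>l. real (Suc l) powr (- (2 * \<alpha>)) / (gap_dist \<gamma> n (Suc l))\<^sup>2) \<and>
      (\<Sum>l. real (Suc l) powr (- (2 * \<alpha>)) / (gap_dist \<gamma> n (Suc l))\<^sup>2) \<le> CT * tau_rate (2 * \<alpha>) \<gamma> n"
    using tau_series_bound[OF \<gamma> exponents] by (elim exE conjE)
  \<comment> \<open>For \<open>k = 0\<close> any number serves as \<open>CS\<close>, since it only
    occurs in a power with exponent \<open>k\<close>.\<close>
  obtain CS where CS: "k = 0 \<or> (\<forall>n\<ge>1.
      summable (\<lambda>l. real (Suc l) powr (- (2 * \<alpha>)) / gap_dist \<gamma> n (Suc l)) \<and>
      (\<Sum>l. real (Suc l) powr (- (2 * \<alpha>)) / gap_dist \<gamma> n (Suc l)) \<le> CS * sigma_rate (2 * \<alpha>) \<gamma> n)"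
  proof (cases "k = 0")
    case False
    then have "2 * \<alpha> + \<gamma> > 1"
      using k by simp
    from sigma_series_bound[OF \<gamma> this] show thesis
      by (elim exE conjE) (rule that, rule disjI2)
  qed (use that in simp)
  define c where "c = gap_const / 2"
  have c: "c > 0"
    using gap_const_pos by (simp add: c_def)
  define D where "D = 8 * ((2 powr \<bar>\<gamma> - 1\<bar> + 1) * (\<kappa> / 2))"
  have D: "D > 0"
    using \<kappa> by (auto simp: D_def intro!: mult_pos_pos add_pos_pos)
  \<comment> \<open>In order: the Cauchy prefactor, the speed of the contour, the first
    \<open>B\<close>, the \<open>k\<close> further ones, and the outer \<open>K\<close>. The powers
    of \<open>c\<close> come from replacing the distances by \<open>c\<close> times
    \<open>gap_dist\<close>.\<close>
  define C where "C = 1 / (2 * pi) * (D * (M / c * (M / c * CS) ^ k * (sqrt CT / c)))"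
  show thesis
  proof (rule that[of C])
    fix n assume n: "2 * N0 \<le> n"
    then have n1: "n \<ge> 1"
      using N0 by simp
    let ?d = "\<lambda>l. gap_dist \<gamma> n (Suc l)" and ?w = "\<lambda>l. real (Suc l) powr (- (2 * \<alpha>))"
    let ?\<sigma> = "sigma_rate (2 * \<alpha>) \<gamma> n" and ?\<tau> = "tau_rate (2 * \<alpha>) \<gamma> n"
    define \<rho> where "\<rho> = (\<lambda>l. c * ?d l)"
    have d_pos: "?d l > 0" for l
      by (rule gap_dist_pos[OF n1])
    have \<rho>1: "(\<lambda>l. ?w l / \<rho> l) = (\<lambda>l. 1 / c * (?w l / ?d l))"
      by (simp add: \<rho>_def)
    have \<rho>2: "(\<lambda>l. ?w l / (\<rho> l)\<^sup>2) = (\<lambda>l. 1 / c\<^sup>2 * (?w l / (?d l)\<^sup>2))"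
      by (simp add: \<rho>_def power_mult_distrib)
    have T: "summable (\<lambda>l. ?w l / (\<rho> l)\<^sup>2)" "(\<Sum>l. ?w l / (\<rho> l)\<^sup>2) \<le> 1 / c\<^sup>2 * (CT * ?\<tau>)"
    proof -
      note T = CT(2)[rule_format, OF n1]
      show "summable (\<lambda>l. ?w l / (\<rho> l)\<^sup>2)"
        unfolding \<rho>2 using T by (intro summable_mult) blast
      have "(\<Sum>l. ?w l / (\<rho> l)\<^sup>2) = 1 / c\<^sup>2 * (\<Sum>l. ?w l / (?d l)\<^sup>2)"
        unfolding \<rho>2 using T by (intro suminf_mult) blast
      also have "\<dots> \<le> 1 / c\<^sup>2 * (CT * ?\<tau>)"
        using T by (intro mult_left_mono) auto
      finally show "(\<Sum>l. ?w l / (\<rho> l)\<^sup>2) \<le> 1 / c\<^sup>2 * (CT * ?\<tau>)" .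
    qed
    have T_nonneg: "0 \<le> sqrt (\<Sum>l. ?w l / (\<rho> l)\<^sup>2)"
      by (intro real_sqrt_ge_zero suminf_nonneg T(1)) simp
    have S: "k = 0 \<or> summable (\<lambda>l. ?w l / \<rho> l)"
    proof (cases "k = 0")
      case False
      then have "summable (\<lambda>l. ?w l / ?d l)"
        using CS n1 by blast
      then show ?thesis
        unfolding \<rho>1 by (intro disjI2 summable_mult)
    qed simp
    have S_pow: "(M * (\<Sum>l. ?w l / \<rho> l)) ^ k \<le> (M / c * CS) ^ k * ?\<sigma> ^ k"
      "0 \<le> (M * (\<Sum>l. ?w l / \<rho> l)) ^ k"
    proof -
      have "(M * (\<Sum>l. ?w l / \<rho> l)) ^ k \<le> (M / c * CS) ^ k * ?\<sigma> ^ k \<and>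
          0 \<le> (M * (\<Sum>l. ?w l / \<rho> l)) ^ k"
      \<comment> \<open>For \<open>k = 0\<close> both powers are 1, whatever value
        \<open>suminf\<close> takes on a divergent series.\<close>
      proof (cases "k = 0")
        case False
        then have S': "summable (\<lambda>l. ?w l / ?d l)" "(\<Sum>l. ?w l / ?d l) \<le> CS * ?\<sigma>"
          using CS n1 by auto
        have eq: "M * (\<Sum>l. ?w l / \<rho> l) = M / c * (\<Sum>l. ?w l / ?d l)"
          unfolding \<rho>1 suminf_mult[OF S'(1)] by simp
        also have "\<dots> \<le> M / c * (CS * ?\<sigma>)"
          using S' M c by (intro mult_left_mono) auto
        finally have le: "M * (\<Sum>l. ?w l / \<rho> l) \<le> M / c * CS * ?\<sigma>"
          by simp
        have "0 \<le> (\<Sum>l. ?w l / ?d l)"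
          using d_pos by (intro suminf_nonneg[OF S'(1)]) (simp add: less_imp_le)
        then have nonneg: "0 \<le> M * (\<Sum>l. ?w l / \<rho> l)"
          unfolding eq using M c by simp
        then show ?thesis
          using power_mono[OF le nonneg, of k] zero_le_power[OF nonneg, of k]
          by (simp only: power_mult_distrib[of "M / c * CS"])
      qed simp
      then show "(M * (\<Sum>l. ?w l / \<rho> l)) ^ k \<le> (M / c * CS) ^ k * ?\<sigma> ^ k"
        "0 \<le> (M * (\<Sum>l. ?w l / \<rho> l)) ^ k"
        by auto
    qed
    define F where "F = M * real n powr (- \<alpha>) / \<rho> (n - 1) *
      (M * (\<Sum>l. ?w l / \<rho> l)) ^ k * sqrt (\<Sum>l. ?w l / (\<rho> l)\<^sup>2)"
    \<comment> \<open>This power of \<open>n\<close> cancels the one in the speed of the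
      contour.\<close>
    have \<rho>_n: "\<rho> (n - 1) = c * real n powr (\<gamma> - 1)"
      using n1 by (simp add: \<rho>_def gap_dist_def)
    have \<rho>_n_pos: "\<rho> (n - 1) > 0"
      unfolding \<rho>_n using c n1 by simp
    have F: "F \<le> M * real n powr (- \<alpha>) / \<rho> (n - 1) * ((M / c * CS) ^ k * ?\<sigma> ^ k) *
        sqrt (1 / c\<^sup>2 * (CT * ?\<tau>))"
      unfolding F_def
    proof (rule mult_mono[OF mult_left_mono[OF S_pow(1)] real_sqrt_le_mono[OF T(2)]])
      show "0 \<le> M * real n powr (- \<alpha>) / \<rho> (n - 1)"
        using M \<rho>_n_pos by simp
      then show "0 \<le> M * real n powr (- \<alpha>) / \<rho> (n - 1) * ((M / c * CS) ^ k * ?\<sigma> ^ k)"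
        by (rule mult_nonneg_nonneg[OF _ order_trans[OF S_pow(2,1)]])
    qed (rule T_nonneg)
    have F_nonneg: "0 \<le> F"
      unfolding F_def using M \<rho>_n_pos
      by (intro mult_nonneg_nonneg divide_nonneg_pos S_pow(2) T_nonneg) auto
    have L: "8 * ((2 powr \<bar>\<gamma> - 1\<bar> + 1) * right_half_width n) = D * real n powr (\<gamma> - 1)"
      by (simp add: D_def right_half_width_def)
    have "norm (vector_contour_integral (Gamma_contour \<kappa> \<gamma> \<mu> n)
        (\<lambda>z. K_op \<mu> \<psi> z ((B_op \<mu> \<psi> b z ^^ Suc k) (K_op \<mu> \<psi> z (\<psi> n))))) \<le>
        D * real n powr (\<gamma> - 1) * F"
    proof (rule norm_vector_contour_integral_le)
      show "derivative_bounded (Gamma_contour \<kappa> \<gamma> \<mu> n) (D * real n powr (\<gamma> - 1))"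
        using derivative_bounded_Gamma[OF n] unfolding L .
      show "norm (K_op \<mu> \<psi> z ((B_op \<mu> \<psi> b z ^^ Suc k) (K_op \<mu> \<psi> z (\<psi> n)))) \<le> F"
        if "z \<in> path_image (Gamma_contour \<kappa> \<gamma> \<mu> n)" for z
        unfolding F_def by (rule norm_KBK_contour[OF n that _ S T(1)]) (simp add: \<rho>_def c_def)
    qed (use D F_nonneg in auto)
    also have "\<dots> \<le> D * real n powr (\<gamma> - 1) * (M * real n powr (- \<alpha>) / \<rho> (n - 1) *
        ((M / c * CS) ^ k * ?\<sigma> ^ k) * sqrt (1 / c\<^sup>2 * (CT * ?\<tau>)))"
      using D by (intro mult_left_mono F) auto
    also have "\<dots> = D * (M / c * (M / c * CS) ^ k * (sqrt CT / c)) *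
        (real n powr (- \<alpha>) * ?\<sigma> ^ k * sqrt ?\<tau>)"
      unfolding \<rho>_n using c n1 by (simp add: real_sqrt_mult real_sqrt_divide)
    finally have "1 / (2 * pi) * norm (vector_contour_integral (Gamma_contour \<kappa> \<gamma> \<mu> n)
        (\<lambda>z. K_op \<mu> \<psi> z ((B_op \<mu> \<psi> b z ^^ Suc k) (K_op \<mu> \<psi> z (\<psi> n))))) \<le>
        1 / (2 * pi) * (D * (M / c * (M / c * CS) ^ k * (sqrt CT / c)) *
        (real n powr (- \<alpha>) * ?\<sigma> ^ k * sqrt ?\<tau>))"
      by (intro mult_left_mono) auto
    then show "norm (phi \<kappa> \<gamma> \<mu> \<psi> b (Suc k) n) \<le> C * (real n powr (- \<alpha>) * ?\<sigma> ^ k * sqrt ?\<tau>)"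
      unfolding phi_def C_def norm_scaleC mult.assoc
      by (simp add: norm_divide norm_mult)
  qed
qed

lemma phi_bigo:
  assumes "2 * \<alpha> + 2 * \<gamma> > 1" "k = 0 \<or> 2 * \<alpha> + \<gamma> > 1"
  shows "(\<lambda>n. norm (phi \<kappa> \<gamma> \<mu> \<psi> b (Suc k) n)) \<in>
    O(\<lambda>n. real n powr (- \<alpha>) * sigma_rate (2 * \<alpha>) \<gamma> n ^ k * sqrt (tau_rate (2 * \<alpha>) \<gamma> n))"
proof -
  let ?f = "\<lambda>n. real n powr (- \<alpha>) * sigma_rate (2 * \<alpha>) \<gamma> n ^ k * sqrt (tau_rate (2 * \<alpha>) \<gamma> n)"
  obtain C where C: "\<And>n. 2 * N0 \<le> n \<Longrightarrow> norm (phi \<kappa> \<gamma> \<mu> \<psi> b (Suc k) n) \<le> C * ?f n"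
    using norm_phi_bound[OF assms] by blast
  show ?thesis
  \<comment> \<open>\<open>norm_phi_bound\<close> does not fix the sign of its constant.\<close>
  proof (rule bigoI[of _ "\<bar>C\<bar>"], rule eventually_sequentiallyI)
    fix n assume "2 * N0 \<le> n"
    from C[OF this] have "norm (phi \<kappa> \<gamma> \<mu> \<psi> b (Suc k) n) \<le> \<bar>C * ?f n\<bar>"
      by linarith
    then show "norm (norm (phi \<kappa> \<gamma> \<mu> \<psi> b (Suc k) n)) \<le> \<bar>C\<bar> * norm (?f n)"
      by (simp add: abs_mult)
  qed
qed

end

section \<open>Passage from the operator to the diagonal form\<close>

theorem lemmaA6:
  fixes a b :: "'h::complex_hilbert \<Rightarrow> 'h \<Rightarrow> complex"
    and V D :: "'h set" and A :: "'h \<Rightarrow> 'h"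
    and \<mu> :: "nat \<Rightarrow> real" and \<psi> :: "nat \<Rightarrow> 'h"
    and \<alpha> \<gamma> \<kappa> M :: real and N0 :: nat
  assumes separable: "\<exists>X :: 'h set. countable X \<and> closure X = UNIV"
    and infinite_dimensional: "\<not> (\<exists>X :: 'h set. finite X \<and> cvec.span X = UNIV)"
    and a_form: "sesquilinear_on V a" "closure V = UNIV" "hermitian_on V a"
      "positive_definite_on V a" "closed_form_on V a"
    and A_assoc: "associated_operator V a D A"
    and A_compact: "compact_resolvent D A"
    and eigenvalues: "0 < \<mu> 1" "\<forall>k\<ge>1. \<mu> k \<le> \<mu> (k + 1)"
    and eigenvectors: "\<forall>k\<ge>1. \<psi> k \<in> D \<and> A (\<psi> k) = complex_of_real (\<mu> k) *\<^sub>C \<psi> k"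
    and basis: "orthonormal_basis \<psi>"
    and b_form: "sesquilinear_on V b" "form_bounded_on V a b"
    and parameters: "\<gamma> > 0" "\<kappa> > 0" "N0 > 0" "M > 0"
    and gaps: "\<forall>k\<ge>N0. \<mu> (k + 1) - \<mu> k \<ge> \<kappa> * real k powr (\<gamma> - 1)"
    and b_bound: "\<forall>m\<ge>1. \<forall>n\<ge>1.
      norm (b (\<psi> m) (\<psi> n)) \<le> M * real m powr (- \<alpha>) * real n powr (- \<alpha>)"
    and exponents: "2 * \<alpha> + 2 * \<gamma> > 1"
  shows "(\<lambda>n. norm (phi \<kappa> \<gamma> \<mu> \<psi> b 1 n)) \<in>
      O(\<lambda>n. real n powr (- \<alpha>) * sqrt (tau_rate (2 * \<alpha>) \<gamma> n))
    \<and> (2 * \<alpha> + \<gamma> > 1 \<longrightarrow> (\<forall>k\<ge>2.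
        (\<lambda>n. norm (phi \<kappa> \<gamma> \<mu> \<psi> b k n)) \<in>
        O(\<lambda>n. real n powr (- \<alpha>) * sigma_rate (2 * \<alpha>) \<gamma> n ^ (k - 1) *
          sqrt (tau_rate (2 * \<alpha>) \<gamma> n))))"
proof -
  obtain S where S: "square_root_of V S D A"
    and a_S: "\<And>u v. u \<in> V \<Longrightarrow> v \<in> V \<Longrightarrow> a u v = cinner (S u) (S v)"
    using A_assoc unfolding associated_operator_def by blast
  have S_adj: "cinner (S u) v = cinner u (S v)" if "u \<in> V" "v \<in> V" for u v
    using S that unfolding square_root_of_def self_adjoint_def by blast
  \<comment> \<open>Because \<open>S (\<psi> k)\<close> lies in \<open>V\<close> again,
    \<open>S\<close> can be moved across the inner product in
    \<open>a (\<psi> j) (\<psi> k)\<close>, which leaves \<open>S (S (\<psi> k))\<close>.\<close>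
  have \<psi>: "\<psi> k \<in> V" "S (\<psi> k) \<in> V" "S (S (\<psi> k)) = complex_of_real (\<mu> k) *\<^sub>C \<psi> k" if "k \<ge> 1" for k
    using S eigenvectors that unfolding square_root_of_def by auto
  have orth: "cinner (\<psi> j) (\<psi> k) = (if j = k then 1 else 0)" if "j \<ge> 1" "k \<ge> 1" for j k
    using basis that unfolding orthonormal_basis_def by blast
  have range: "range (\<lambda>k. \<psi> (Suc k)) = \<psi> ` {1..}"
    by (simp add: atLeast_Suc_greaterThan greaterThan_0 image_image)
  have a_diag: "a (\<psi> j) (\<psi> k) = (if j = k then complex_of_real (\<mu> k) else 0)"
    if "j \<ge> 1" "k \<ge> 1" for j k
    using that by (simp add: a_S \<psi> S_adj cinner_scaleC_right orth)
  interpret perturbed_operator \<mu> \<kappa> \<gamma> N0 \<psi> V a b \<alpha> M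
  proof unfold_locales
    show "closure (cvec.span (range (\<lambda>k. \<psi> (Suc k)))) = UNIV"
      unfolding range using basis by (simp add: orthonormal_basis_def)
    show "0 \<le> Re (a u u)" if "u \<in> V" for u
      using that by (simp add: a_S cinner_self)
  qed (use parameters eigenvalues gaps a_form b_form b_bound in \<open>auto simp: orth \<psi> a_diag\<close>)
  show ?thesis
  proof (intro conjI impI allI)
    show "(\<lambda>n. norm (phi \<kappa> \<gamma> \<mu> \<psi> b 1 n)) \<in>
        O(\<lambda>n. real n powr (- \<alpha>) * sqrt (tau_rate (2 * \<alpha>) \<gamma> n))"
      using phi_bigo[OF exponents, of 0] by simp
    fix k :: nat assume "2 * \<alpha> + \<gamma> > 1" "k \<ge> 2"
    then show "(\<lambda>n. norm (phi \<kappa> \<gamma> \<mu> \<psi> b k n)) \<in> O(\<lambda>n. real n powr (- \<alpha>) *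
        sigma_rate (2 * \<alpha>) \<gamma> n ^ (k - 1) * sqrt (tau_rate (2 * \<alpha>) \<gamma> n))"
      \<comment> \<open>\<open>phi_bigo\<close> treats the term of order
        \<open>Suc k\<close>.\<close>
      using phi_bigo[OF exponents, of "k - 1"] by simp
  qed
qed

end
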